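(* Fix $T\in\mathbb N$ and let $\boldsymbol\pi_{T,D}=\pi_T^{\otimes D}$ be the $D$-fold product Feynman--Kac target described in the context. Assume $\inf_{t\in[T]} r_{t|T}>0$ and, if the algorithm is used with backward sampling, also $\inf_{t\in[T-1]} b_{t|T}>0$. For each of the versions of the i-CSMC algorithm (with or without backward sampling, with or without the forced-move extension), let $d^{N}_{T,D,\mathbf x_{1:T}}$ be the total variation distance between the law of $(A_{1:T-1},K_{1:T})$ generated by one i-CSMC update with $N+1$ particles started from $\mathbf x_{1:T}\in(\mathbb R^D)^T$, and the point mass at $0$, i.e. the law under which all ancestor indices $A_t^n$ ($t\in[T-1]$, $n\in[N]_0$) and all indices $K_t$ ($t\in[T]$) equal $0$. Then there exists a family of Borel sets $\mathbf F_{T,D}\subseteq(\mathbb R^D)^T$, $D\ge 1$, with $\lim_{D\to\infty}\boldsymbol\pi_{T,D}(\mathbf F_{T,D})=1$ such that, for $N=N(D)\in\mathbb N$, $$\log N(D)=o(D)\quad\Longrightarrow\quad \lim_{D\to\infty}\ \sup_{\mathbf x_{1:T}\in\mathbf F_{T,D}} d^{N(D)}_{T,D,\mathbf x_{1:T}}=0 .$$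
   Context: Notation: $[n]=\{1,\dots,n\}$, $[n]_0=\{0,1,\dots,n\}$. Any quantity with time index $0$ is ignored (e.g. $M_1(x_0,\cdot)\equiv M_1(\cdot)$). Model. $M_1$ is a probability measure on $\mathbb R$ with Lebesgue density $m_1$; for $t\ge2$, $M_t$ is a Markov kernel on $\mathbb R$ with transition density $m_t(x,y)$; $G_t:\mathbb R\to(0,\infty)$ is measurable. $\pi_T$ is the probability measure on $\mathbb R^T$ given by $\pi_T(dx_{1:T})\propto M_1(dx_1)G_1(x_1)\prod_{t=2}^T M_t(x_{t-1},dx_t)G_t(x_t)$. For $D\in\mathbb N$ and $\mathbf x_t=(x_{t,1},\dots,x_{t,D})\in\mathbb R^D$ put $\mathbf M_t(\mathbf x_{t-1},d\mathbf x_t)=\prod_{d=1}^D M_t(x_{t-1,d},dx_{t,d})$, with density $\mathbf m_t(\mathbf x_{t-1},\mathbf x_t)=\prod_d m_t(x_{t-1,d},x_{t,d})$, and $\mathbf G_t(\mathbf x_t)=\prod_{d=1}^D G_t(x_{t,d})$. The target is $\boldsymbol\pi_{T,D}(d\mathbf x_{1:T})\propto \mathbf M_1(d\mathbf x_1)\mathbf G_1(\mathbf x_1)\prod_{t=2}^T\mathbf M_t(\mathbf x_{t-1},d\mathbf x_t)\mathbf G_t(\mathbf x_t)$, i.e. $\boldsymbol\pi_{T,D}=\pi_T^{\otimes D}$. With $X_{1:T}\sim\pi_T$ and $M_t(f)(x)=\int f(y)M_t(x,dy)$, define $r_{t|T}=\mathbb E[\log G_t(X_t)]-\mathbb E[\log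 M_t(G_t)(X_{t-1})]$ and $b_{t|T}=\mathbb E[\log G_t(X_t)+\log m_{t+1}(X_t,X_{t+1})]-\mathbb E[\log M_t(G_t\,m_{t+1}(\cdot,X_{t+1}))(X_{t-1})]$, all these expectations existing as real numbers so that $r_{t|T}$ (and, when used, $b_{t|T}$) is well defined. Selection functions. For $h^{1:N}\in\mathbb R^N$, $h^0:=0$: $\Psi^n(\{h^m\}_{m=1}^N)=\frac{e^{h^n}}{1+\sum_{m=1}^N e^{h^m}}$ for $n\in[N]_0$; $\Phi^n(\{h^m\}_{m=1}^N)=\frac{e^{h^n}}{1-1\wedge e^{h^n}+\sum_{m=1}^N e^{h^m}}$ for $n\in[N]$ and $\Phi^0=1-\sum_{n=1}^N\Phi^n$. One i-CSMC update from $\mathbf x_{1:T}$. For $t=1,\dots,T$: (a) if $t>1$, set $A_{t-1}^0=0$ and, conditionally independently for $n\in[N]$, sample $A_{t-1}^n=l\in[N]_0$ with probability $\mathbf G_{t-1}(\mathbf Z_{t-1}^l)/\sum_{m=0}^N\mathbf G_{t-1}(\mathbf Z_{t-1}^m)$; (b) set $\mathbf Z_t^0=\mathbf x_t$ and, conditionally independently for $n\in[N]$, sample $\mathbf Z_t^n\sim\mathbf M_t(\mathbf Z_{t-1}^{A_{t-1}^n},\cdot)$. Then sample $K_T=k\in[N]_0$ with probability $\Psi^k(\{\log\mathbf G_T(\mathbf Z_T^m)-\log\mathbf G_T(\mathbf Z_T^0)\}_{m=1}^N)$; the forced-move extension replaces $\Psi^k$ by $\Phi^k$ here. Then for $t=T-1,\dots,1$: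 without backward sampling, set $K_t=A_t^{K_{t+1}}$; with backward sampling, instead sample $K_t=k\in[N]_0$ with probability $\frac{\mathbf G_t(\mathbf Z_t^k)\mathbf m_{t+1}(\mathbf Z_t^k,\mathbf Z_{t+1}^{K_{t+1}})}{\sum_{m=0}^N\mathbf G_t(\mathbf Z_t^m)\mathbf m_{t+1}(\mathbf Z_t^m,\mathbf Z_{t+1}^{K_{t+1}})}$. Write $A_t=(A_t^0,\dots,A_t^N)$. The new state is $(\mathbf Z_1^{K_1},\dots,\mathbf Z_T^{K_T})$. *)

theory Defs
  imports "HOL-Probability.Probability" "HOL-Library.Landau_Symbols"
begin

text \<open>
  \<open>m t x y\<close> is the density at \<open>y\<close> of the Markov kernel \<open>M\<^sub>t(x, \<cdot>)\<close>.  Time indices start at \<open>1\<close>; the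
  initial law \<open>M\<^sub>1\<close> has density \<open>m 1 x\<close>, which does not depend on the dummy argument \<open>x\<close>.
\<close>

locale feynman_kac_model =
  fixes m :: "nat \<Rightarrow> real \<Rightarrow> real \<Rightarrow> real" and G :: "nat \<Rightarrow> real \<Rightarrow> real"
  assumes m_measurable: "\<And>t. t \<ge> 1 \<Longrightarrow> (\<lambda>(x, y). m t x y) \<in> borel_measurable (borel \<Otimes>\<^sub>M borel)"
    and m_nonneg: "\<And>t x y. t \<ge> 1 \<Longrightarrow> m t x y \<ge> 0"
    and m_prob: "\<And>t x. t \<ge> 1 \<Longrightarrow> (\<integral>\<^sup>+ y. ennreal (m t x y) \<partial>lborel) = 1"
    and m_initial: "\<And>x x'. m 1 x = m 1 x'"
    and G_measurable: "\<And>t. t \<ge> 1 \<Longrightarrow> G t \<in> borel_measurable borel"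
    and G_pos: "\<And>t x. t \<ge> 1 \<Longrightarrow> G t x > 0"

definition Mker :: "(nat \<Rightarrow> real \<Rightarrow> real \<Rightarrow> real) \<Rightarrow> nat \<Rightarrow> real \<Rightarrow> real measure" where
  "Mker m t x = density lborel (\<lambda>y. ennreal (m t x y))"

definition Mop :: "(nat \<Rightarrow> real \<Rightarrow> real \<Rightarrow> real) \<Rightarrow> nat \<Rightarrow> (real \<Rightarrow> real) \<Rightarrow> real \<Rightarrow> real" where
  "Mop m t f x = (\<integral>y. f y \<partial>Mker m t x)"

text \<open>
  A path \<open>x\<^sub>1\<^sub>:\<^sub>T\<close> is an extensional function on \<open>{1..T}\<close>.  At \<open>t = 1\<close> the value \<open>x 0\<close> occurs formally
  below, but only as the dummy argument of \<open>m 1\<close>.  The normalising constant is positive because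
  every \<open>G t\<close> is and the kernels are Markov; if it is infinite, \<open>fk_target\<close> is the null measure, so the requirement that
  \<open>fk_target\<close> is a probability measure says exactly that it is finite.
\<close>

definition fk_weight ::
    "(nat \<Rightarrow> real \<Rightarrow> real \<Rightarrow> real) \<Rightarrow> (nat \<Rightarrow> real \<Rightarrow> real) \<Rightarrow> nat \<Rightarrow> (nat \<Rightarrow> real) \<Rightarrow> real" where
  "fk_weight m G T x = (\<Prod>t = 1..T. m t (x (t - 1)) (x t) * G t (x t))"

definition fk_norm ::
    "(nat \<Rightarrow> real \<Rightarrow> real \<Rightarrow> real) \<Rightarrow> (nat \<Rightarrow> real \<Rightarrow> real) \<Rightarrow> nat \<Rightarrow> ennreal" where
  "fk_norm m G T = (\<integral>\<^sup>+ x. ennreal (fk_weight m G T x) \<partial>(\<Pi>\<^sub>M t\<in>{1..T}. lborel))"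

definition fk_target ::
    "(nat \<Rightarrow> real \<Rightarrow> real \<Rightarrow> real) \<Rightarrow> (nat \<Rightarrow> real \<Rightarrow> real) \<Rightarrow> nat \<Rightarrow> (nat \<Rightarrow> real) measure" where
  "fk_target m G T =
     density (\<Pi>\<^sub>M t\<in>{1..T}. lborel) (\<lambda>x. ennreal (fk_weight m G T x) / fk_norm m G T)"

text \<open>The spaces \<open>\<real>\<^sup>D\<close> and \<open>(\<real>\<^sup>D)\<^sup>T\<close>; \<open>x t d\<close> is the \<open>d\<close>-th coordinate at time \<open>t\<close>.\<close>

definition vec_space :: "nat \<Rightarrow> (nat \<Rightarrow> real) measure" where
  "vec_space D = (\<Pi>\<^sub>M d\<in>{1..D}. borel)"

definition path_space :: "nat \<Rightarrow> nat \<Rightarrow> (nat \<Rightarrow> nat \<Rightarrow> real) measure" where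
  "path_space T D = (\<Pi>\<^sub>M t\<in>{1..T}. vec_space D)"

text \<open>
  The \<open>D\<close>-fold product of the target lives on \<open>(\<real>\<^sup>T)\<^sup>D\<close>; it is transported to \<open>(\<real>\<^sup>D)\<^sup>T\<close> by exchanging
  the two indices.
\<close>

definition fk_target_prod ::
    "(nat \<Rightarrow> real \<Rightarrow> real \<Rightarrow> real) \<Rightarrow> (nat \<Rightarrow> real \<Rightarrow> real) \<Rightarrow> nat \<Rightarrow> nat \<Rightarrow>
      (nat \<Rightarrow> nat \<Rightarrow> real) measure" where
  "fk_target_prod m G T D =
     distr (\<Pi>\<^sub>M d\<in>{1..D}. fk_target m G T) (path_space T D)
       (\<lambda>y. \<lambda>t\<in>{1..T}. \<lambda>d\<in>{1..D}. y d t)"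

text \<open>
  The predicates \<open>r_defined\<close> and \<open>b_defined\<close> say that the expectations involved exist as real numbers.
  The almost-sure integrability conditions are needed because a divergent integral \<open>Mop\<close> would have the
  value \<open>0\<close> here, and \<open>ln 0 = 0\<close>.
\<close>

definition r_defined ::
    "(nat \<Rightarrow> real \<Rightarrow> real \<Rightarrow> real) \<Rightarrow> (nat \<Rightarrow> real \<Rightarrow> real) \<Rightarrow> nat \<Rightarrow> nat \<Rightarrow> bool" where
  "r_defined m G T t \<longleftrightarrow>
     integrable (fk_target m G T) (\<lambda>x. ln (G t (x t))) \<and>
     (AE x in fk_target m G T. integrable (Mker m t (x (t - 1))) (G t)) \<and>
     integrable (fk_target m G T) (\<lambda>x. ln (Mop m t (G t) (x (t - 1))))"

definition r_value ::
    "(nat \<Rightarrow> real \<Rightarrow> real \<Rightarrow> real) \<Rightarrow> (nat \<Rightarrow> real \<Rightarrow> real) \<Rightarrow> nat \<Rightarrow> nat \<Rightarrow> real" where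
  "r_value m G T t =
     (\<integral>x. ln (G t (x t)) \<partial>fk_target m G T) -
     (\<integral>x. ln (Mop m t (G t) (x (t - 1))) \<partial>fk_target m G T)"

definition b_defined ::
    "(nat \<Rightarrow> real \<Rightarrow> real \<Rightarrow> real) \<Rightarrow> (nat \<Rightarrow> real \<Rightarrow> real) \<Rightarrow> nat \<Rightarrow> nat \<Rightarrow> bool" where
  "b_defined m G T t \<longleftrightarrow>
     integrable (fk_target m G T) (\<lambda>x. ln (G t (x t)) + ln (m (t + 1) (x t) (x (t + 1)))) \<and>
     (AE x in fk_target m G T.
        integrable (Mker m t (x (t - 1))) (\<lambda>y. G t y * m (t + 1) y (x (t + 1)))) \<and>
     integrable (fk_target m G T)
       (\<lambda>x. ln (Mop m t (\<lambda>y. G t y * m (t + 1) y (x (t + 1))) (x (t - 1))))"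

definition b_value ::
    "(nat \<Rightarrow> real \<Rightarrow> real \<Rightarrow> real) \<Rightarrow> (nat \<Rightarrow> real \<Rightarrow> real) \<Rightarrow> nat \<Rightarrow> nat \<Rightarrow> real" where
  "b_value m G T t =
     (\<integral>x. ln (G t (x t)) + ln (m (t + 1) (x t) (x (t + 1))) \<partial>fk_target m G T) -
     (\<integral>x. ln (Mop m t (\<lambda>y. G t y * m (t + 1) y (x (t + 1))) (x (t - 1))) \<partial>fk_target m G T)"

definition Psi :: "nat \<Rightarrow> (nat \<Rightarrow> real) \<Rightarrow> nat \<Rightarrow> real" where
  "Psi N h n = exp ((h(0 := 0)) n) / (1 + (\<Sum>k = 1..N. exp (h k)))"

definition Phi :: "nat \<Rightarrow> (nat \<Rightarrow> real) \<Rightarrow> nat \<Rightarrow> real" where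
  "Phi N h n =
     (let p = (\<lambda>n. exp (h n) / (1 - min 1 (exp (h n)) + (\<Sum>k = 1..N. exp (h k))))
      in if n = 0 then 1 - (\<Sum>n = 1..N. p n) else p n)"

definition Mvec ::
    "(nat \<Rightarrow> real \<Rightarrow> real \<Rightarrow> real) \<Rightarrow> nat \<Rightarrow> nat \<Rightarrow> (nat \<Rightarrow> real) \<Rightarrow> (nat \<Rightarrow> real) measure" where
  "Mvec m D t x = (\<Pi>\<^sub>M d\<in>{1..D}. Mker m t (x d))"

definition mvec ::
    "(nat \<Rightarrow> real \<Rightarrow> real \<Rightarrow> real) \<Rightarrow> nat \<Rightarrow> nat \<Rightarrow> (nat \<Rightarrow> real) \<Rightarrow> (nat \<Rightarrow> real) \<Rightarrow> real" where
  "mvec m D t x y = (\<Prod>d = 1..D. m t (x d) (y d))"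

definition Gvec :: "(nat \<Rightarrow> real \<Rightarrow> real) \<Rightarrow> nat \<Rightarrow> nat \<Rightarrow> (nat \<Rightarrow> real) \<Rightarrow> real" where
  "Gvec G D t x = (\<Prod>d = 1..D. G t (x d))"

abbreviation index_space :: "nat \<Rightarrow> nat measure" where
  "index_space N \<equiv> count_space {0..N}"

definition index_law :: "nat \<Rightarrow> (nat \<Rightarrow> real) \<Rightarrow> nat measure" where
  "index_law N p = density (index_space N) (\<lambda>k. ennreal (p k))"

text \<open>
  Sampling an index with probability proportional to \<open>w\<close>.  If all weights vanish (possible in backward
  sampling, when densities vanish), the algorithm is undefined, and this is the null measure because
  \<open>0 / 0 = 0\<close>.  The lost mass makes the total variation distance below only larger.
\<close>

definition weighted_index_law :: "nat \<Rightarrow> (nat \<Rightarrow> real) \<Rightarrow> nat measure" where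
  "weighted_index_law N w = index_law N (\<lambda>k. w k / (\<Sum>l = 0..N. w l))"

definition particle_space :: "nat \<Rightarrow> nat \<Rightarrow> (nat \<Rightarrow> nat \<Rightarrow> real) measure" where
  "particle_space N D = (\<Pi>\<^sub>M n\<in>{0..N}. vec_space D)"

definition ancestor_space :: "nat \<Rightarrow> (nat \<Rightarrow> nat) measure" where
  "ancestor_space N = (\<Pi>\<^sub>M n\<in>{0..N}. index_space N)"

definition resample ::
    "(nat \<Rightarrow> real \<Rightarrow> real) \<Rightarrow> nat \<Rightarrow> nat \<Rightarrow> nat \<Rightarrow> (nat \<Rightarrow> nat \<Rightarrow> real) \<Rightarrow> (nat \<Rightarrow> nat) measure" where
  "resample G N D t z =
     (\<Pi>\<^sub>M n\<in>{0..N}. if n = 0 then return (index_space N) 0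
                       else weighted_index_law N (\<lambda>l. Gvec G D t (z l)))"

text \<open>Here \<open>par n\<close> stands for \<open>Z\<^sub>t\<^sub>-\<^sub>1\<close> at \<open>A\<^sub>t\<^sub>-\<^sub>1 n\<close>; it is a dummy at \<open>t = 1\<close>.\<close>

definition mutate ::
    "(nat \<Rightarrow> real \<Rightarrow> real \<Rightarrow> real) \<Rightarrow> nat \<Rightarrow> nat \<Rightarrow> nat \<Rightarrow> (nat \<Rightarrow> real) \<Rightarrow> (nat \<Rightarrow> nat \<Rightarrow> real) \<Rightarrow>
      (nat \<Rightarrow> nat \<Rightarrow> real) measure" where
  "mutate m N D t xt par =
     (\<Pi>\<^sub>M n\<in>{0..N}. if n = 0 then return (vec_space D) xt else Mvec m D t (par n))"

text \<open>\<open>forward_law \<dots> t\<close> is the joint law of \<open>(Z\<^sub>1\<^sub>:\<^sub>t, A\<^sub>1\<^sub>:\<^sub>t\<^sub>-\<^sub>1)\<close>; \<open>Z t n d\<close> is the \<open>d\<close>-th coordinate of particle \<open>n\<close>.\<close>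

definition forward_space ::
    "nat \<Rightarrow> nat \<Rightarrow> nat \<Rightarrow> ((nat \<Rightarrow> nat \<Rightarrow> nat \<Rightarrow> real) \<times> (nat \<Rightarrow> nat \<Rightarrow> nat)) measure" where
  "forward_space N D t =
     (\<Pi>\<^sub>M s\<in>{1..t}. particle_space N D) \<Otimes>\<^sub>M (\<Pi>\<^sub>M s\<in>{1..<t}. ancestor_space N)"

primrec forward_law ::
    "(nat \<Rightarrow> real \<Rightarrow> real \<Rightarrow> real) \<Rightarrow> (nat \<Rightarrow> real \<Rightarrow> real) \<Rightarrow> nat \<Rightarrow> nat \<Rightarrow> (nat \<Rightarrow> nat \<Rightarrow> real) \<Rightarrow> nat \<Rightarrow>
      ((nat \<Rightarrow> nat \<Rightarrow> nat \<Rightarrow> real) \<times> (nat \<Rightarrow> nat \<Rightarrow> nat)) measure" where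
  "forward_law m G N D x 0 = return (forward_space N D 0) (\<lambda>_. undefined, \<lambda>_. undefined)"
| "forward_law m G N D x (Suc t) =
     (if t = 0 then
        mutate m N D 1 (x 1) (\<lambda>_ _. 0) \<bind> (\<lambda>z.
        return (forward_space N D 1) ((\<lambda>_. undefined)(1 := z), \<lambda>_. undefined))
      else
        forward_law m G N D x t \<bind> (\<lambda>(Z, A).
        resample G N D t (Z t) \<bind> (\<lambda>a.
        mutate m N D (Suc t) (x (Suc t)) (\<lambda>n. Z t (a n)) \<bind> (\<lambda>z.
        return (forward_space N D (Suc t)) (Z(Suc t := z), A(t := a))))))"

text \<open>The law of \<open>K\<^sub>T\<close>; \<open>fm\<close> switches on the forced-move extension.\<close>

definition final_index_law ::
    "bool \<Rightarrow> (nat \<Rightarrow> real \<Rightarrow> real) \<Rightarrow> nat \<Rightarrow> nat \<Rightarrow> nat \<Rightarrow> (nat \<Rightarrow> nat \<Rightarrow> real) \<Rightarrow> nat measure" where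
  "final_index_law fm G N D T z =
     index_law N ((if fm then Phi else Psi) N (\<lambda>n. ln (Gvec G D T (z n)) - ln (Gvec G D T (z 0))))"

text \<open>The law of \<open>K\<^sub>t\<close> given \<open>K\<^sub>t\<^sub>+\<^sub>1 = l\<close>; \<open>bs\<close> switches on backward sampling.\<close>

definition backward_index_law ::
    "bool \<Rightarrow> (nat \<Rightarrow> real \<Rightarrow> real \<Rightarrow> real) \<Rightarrow> (nat \<Rightarrow> real \<Rightarrow> real) \<Rightarrow> nat \<Rightarrow> nat \<Rightarrow>
      (nat \<Rightarrow> nat \<Rightarrow> nat \<Rightarrow> real) \<Rightarrow> (nat \<Rightarrow> nat \<Rightarrow> nat) \<Rightarrow> nat \<Rightarrow> nat \<Rightarrow> nat measure" where
  "backward_index_law bs m G N D Z A t l =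
     (if bs then
        weighted_index_law N (\<lambda>k. Gvec G D t (Z t k) * mvec m D (t + 1) (Z t k) (Z (t + 1) l))
      else return (index_space N) (A t l))"

text \<open>The law of \<open>K\<^sub>1\<^sub>:\<^sub>T\<close> given \<open>K\<close> on \<open>{t+1..T}\<close>, sampling at times \<open>t, \<dots>, 1\<close>.\<close>

primrec backward_law ::
    "bool \<Rightarrow> (nat \<Rightarrow> real \<Rightarrow> real \<Rightarrow> real) \<Rightarrow> (nat \<Rightarrow> real \<Rightarrow> real) \<Rightarrow> nat \<Rightarrow> nat \<Rightarrow> nat \<Rightarrow>
      (nat \<Rightarrow> nat \<Rightarrow> nat \<Rightarrow> real) \<Rightarrow> (nat \<Rightarrow> nat \<Rightarrow> nat) \<Rightarrow> nat \<Rightarrow> (nat \<Rightarrow> nat) \<Rightarrow> (nat \<Rightarrow> nat) measure" where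
  "backward_law bs m G N D T Z A 0 K = return (\<Pi>\<^sub>M t\<in>{1..T}. index_space N) K"
| "backward_law bs m G N D T Z A (Suc t) K =
     backward_index_law bs m G N D Z A (Suc t) (K (Suc (Suc t))) \<bind> (\<lambda>k.
     backward_law bs m G N D T Z A t (K(Suc t := k)))"

definition indices_space :: "nat \<Rightarrow> nat \<Rightarrow> ((nat \<Rightarrow> nat \<Rightarrow> nat) \<times> (nat \<Rightarrow> nat)) measure" where
  "indices_space N T = (\<Pi>\<^sub>M t\<in>{1..<T}. ancestor_space N) \<Otimes>\<^sub>M (\<Pi>\<^sub>M t\<in>{1..T}. index_space N)"

definition icsmc_indices_law ::
    "bool \<Rightarrow> bool \<Rightarrow> (nat \<Rightarrow> real \<Rightarrow> real \<Rightarrow> real) \<Rightarrow> (nat \<Rightarrow> real \<Rightarrow> real) \<Rightarrow> nat \<Rightarrow> nat \<Rightarrow> nat \<Rightarrow>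
      (nat \<Rightarrow> nat \<Rightarrow> real) \<Rightarrow> ((nat \<Rightarrow> nat \<Rightarrow> nat) \<times> (nat \<Rightarrow> nat)) measure" where
  "icsmc_indices_law bs fm m G N T D x =
     forward_law m G N D x T \<bind> (\<lambda>(Z, A).
     final_index_law fm G N D T (Z T) \<bind> (\<lambda>k.
     backward_law bs m G N D T Z A (T - 1) ((\<lambda>_. undefined)(T := k)) \<bind> (\<lambda>K.
     return (indices_space N T) (A, K))))"

definition zero_indices_law :: "nat \<Rightarrow> nat \<Rightarrow> ((nat \<Rightarrow> nat \<Rightarrow> nat) \<times> (nat \<Rightarrow> nat)) measure" where
  "zero_indices_law N T =
     return (indices_space N T) (\<lambda>t\<in>{1..<T}. \<lambda>n\<in>{0..N}. 0, \<lambda>t\<in>{1..T}. 0)"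

text \<open>Normalised to take values in \<open>[0, 1]\<close> (not the \<open>L\<^sup>1\<close> distance, which is twice as large).\<close>

definition tv_dist :: "'a measure \<Rightarrow> 'a measure \<Rightarrow> real" where
  "tv_dist P Q = (SUP B\<in>sets P. \<bar>measure P B - measure Q B\<bar>)"

definition icsmc_dist ::
    "bool \<Rightarrow> bool \<Rightarrow> (nat \<Rightarrow> real \<Rightarrow> real \<Rightarrow> real) \<Rightarrow> (nat \<Rightarrow> real \<Rightarrow> real) \<Rightarrow> nat \<Rightarrow> nat \<Rightarrow> nat \<Rightarrow>
      (nat \<Rightarrow> nat \<Rightarrow> real) \<Rightarrow> real" where
  "icsmc_dist bs fm m G N T D x =
     tv_dist (icsmc_indices_law bs fm m G N T D x) (zero_indices_law N T)"

end

theory Submission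
  imports Defs
begin

text \<open>
  If all indices vanish up to time \<open>t - 1\<close>, the \<open>N\<close> free particles at time \<open>t\<close> are i.i.d. draws from
  \<open>\<^bold>M\<^sub>t(\<^bold>x\<^sub>t\<^sub>-\<^sub>1, \<cdot>)\<close>, independently of the past. Hence the probability that every index is \<open>0\<close>
  is at least a product over \<open>t\<close> of expectations of selection probabilities, and \<open>1 / (1 + a) \<ge> 1 - a\<close>
  together with Bernoulli's inequality bounds each factor from below by \<open>1 - N (N q\<^sub>t + p\<^sub>t)\<close>, where \<open>q\<^sub>t\<close> and \<open>p\<^sub>t\<close>
  are the expected weights of a free particle relative to the reference particle, in resampling and in backward
  sampling. Both are products over the \<open>D\<close> coordinates, of the form \<open>exp (- (\<xi>\<^sub>1 + \<dots> + \<xi>\<^sub>D))\<close> with \<open>\<xi>\<^sub>d\<close> i.i.d.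
  under the target of mean \<open>r\<close> or \<open>b\<close>. By the weak law of large numbers they are at most \<open>exp (- c D)\<close> on a set of
  probability tending to \<open>1\<close>, which beats \<open>N\<^sup>2 = exp (o(D))\<close>.
\<close>

subsection \<open>Product kernels, bind and total variation\<close>

text \<open>Only the atom at the all-zero index vector has to be bounded from below, so every bind
  of the algorithm is cut down to its zero branch and no law is computed exactly. On that branch the
  backward-sampling weights at time \<open>s\<close> involve only the particles at time
  \<open>s\<close> and the fixed point \<open>x (s + 1)\<close>, because \<open>K\<close> at time
  \<open>s + 1\<close> is \<open>0\<close>. Resampling at time \<open>s\<close> also sees only these
  particles, so both selection probabilities stand as a product under one integral per time step.
  The log-ratios are merely integrable, so the law of large numbers goes through truncation and
  Hoeffding's inequality instead of variances. Where densities vanish or integrals diverge,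
  logarithms and integrals take default values; the good sets therefore also demand, coordinate by
  coordinate, positivity and integrability, which hold almost surely under the target. Their
  threshold is half the smallest mean, so one family of sets serves every \<open>N\<close>.\<close>

lemma emeasure_PiM_prob:
  assumes "finite I" "\<And>i. i \<in> I \<Longrightarrow> prob_space (M i)" "\<And>i. i \<in> I \<Longrightarrow> A i \<in> sets (M i)"
  shows "emeasure (PiM I M) (Pi\<^sub>E I A) = (\<Prod>i\<in>I. emeasure (M i) (A i))"
  using emeasure_PiM_emb[of I M I A] assms
  by (simp add: prod_emb_PiE_same_index sets.sets_into_space)

lemma nn_integral_PiM_prod_prob:
  assumes "finite I" "\<And>i. i \<in> I \<Longrightarrow> prob_space (M i)"
    and "\<And>i. i \<in> I \<Longrightarrow> f i \<in> borel_measurable (M i)"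
  shows "(\<integral>\<^sup>+ x. (\<Prod>i\<in>I. f i (x i)) \<partial>PiM I M) = (\<Prod>i\<in>I. integral\<^sup>N (M i) (f i))"
proof -
  \<comment> \<open>The product locale quantifies over all indices. Off \<open>I\<close> the family
    is completed by a one-point probability space, which \<open>PiM I\<close> never reads.\<close>
  define M' where "M' i = (if i \<in> I then M i else count_space {undefined})" for i
  have "prob_space (M' i)" for i
    using assms(2) by (auto simp: M'_def intro!: prob_space_uniform_count_measure prob_spaceI)
  then interpret product_sigma_finite M'
    by (auto simp: product_sigma_finite_def intro: prob_space_imp_sigma_finite)
  have "PiM I M = PiM I M'"
    by (intro PiM_cong) (auto simp: M'_def)
  then have "(\<integral>\<^sup>+ x. (\<Prod>i\<in>I. f i (x i)) \<partial>PiM I M) = (\<Prod>i\<in>I. integral\<^sup>N (M' i) (f i))"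
    using product_nn_integral_prod[of I f] assms by (simp add: M'_def)
  then show ?thesis
    by (simp add: M'_def)
qed

text \<open>Measurability of a kernel need only be tested on an intersection-stable generator; on
  boxes the product measure is a finite product of the measurable maps
  \<open>emeasure (K x i) (E i)\<close>.\<close>

lemma measurable_PiM_kernel:
  assumes "finite I" and K: "\<And>i. i \<in> I \<Longrightarrow> (\<lambda>x. K x i) \<in> X \<rightarrow>\<^sub>M prob_algebra (M i)"
  shows "(\<lambda>x. PiM I (K x)) \<in> X \<rightarrow>\<^sub>M prob_algebra (PiM I M)"
proof (rule measurable_prob_algebra_generated[OF sets_PiM Int_stable_prod_algebra prod_algebra_sets_into_space])
  have sp: "prob_space (K x i)" "sets (K x i) = sets (M i)" if "x \<in> space X" "i \<in> I" for x i
    using measurable_space[OF K[OF that(2)] that(1)] by (auto simp: space_prob_algebra)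
  fix x assume "x \<in> space X"
  then show "prob_space (PiM I (K x))" "sets (PiM I (K x)) = sets (PiM I M)"
    using sp by (auto intro!: prob_space_PiM sets_PiM_cong)
next
  have sp: "prob_space (K x i)" "sets (K x i) = sets (M i)" if "x \<in> space X" "i \<in> I" for x i
    using measurable_space[OF K[OF that(2)] that(1)] by (auto simp: space_prob_algebra)
  fix A assume "A \<in> prod_algebra I M"
  then obtain E where A: "A = Pi\<^sub>E I E" and E: "\<And>i. i \<in> I \<Longrightarrow> E i \<in> sets (M i)"
    using assms(1) by (auto simp: prod_algebra_eq_finite)
  have "(\<lambda>x. \<Prod>i\<in>I. emeasure (K x i) (E i)) \<in> borel_measurable X"
    using E K by (intro borel_measurable_prod_ennreal
        measurable_compose[OF _ measurable_emeasure_subprob_algebra] measurable_prob_algebraD) auto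
  then show "(\<lambda>x. emeasure (PiM I (K x)) A) \<in> borel_measurable X"
    by (subst measurable_cong[where g="\<lambda>x. \<Prod>i\<in>I. emeasure (K x i) (E i)"])
      (auto simp: A assms(1) sp E intro!: emeasure_PiM_prob)
qed

text \<open>Everything in the outer integral except the atom \<open>a\<close> is discarded. With
  \<open>a\<close> the all-zero choice, this follows nested binds along a single branch.\<close>

lemma nn_integral_bind_ge:
  assumes f: "f \<in> M \<rightarrow>\<^sub>M subprob_algebra N" and a: "{a} \<in> sets M" and h: "h \<in> borel_measurable N"
  shows "emeasure M {a} * (\<integral>\<^sup>+y. h y \<partial>f a) \<le> (\<integral>\<^sup>+y. h y \<partial>(M \<bind> f))"
proof -
  have "emeasure M {a} * (\<integral>\<^sup>+y. h y \<partial>f a) = (\<integral>\<^sup>+x. (\<integral>\<^sup>+y. h y \<partial>f a) * indicator {a} x \<partial>M)"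
    using a by (simp add: nn_integral_cmult_indicator mult.commute)
  also have "\<dots> \<le> (\<integral>\<^sup>+x. (\<integral>\<^sup>+y. h y \<partial>f x) \<partial>M)"
    by (intro nn_integral_mono) (auto split: split_indicator)
  also have "\<dots> = (\<integral>\<^sup>+y. h y \<partial>(M \<bind> f))"
    using f h by (intro nn_integral_bind[symmetric]) auto
  finally show ?thesis .
qed

lemma emeasure_bind_ge:
  assumes f: "f \<in> M \<rightarrow>\<^sub>M subprob_algebra N" and a: "a \<in> space M" "{a} \<in> sets M" and B: "B \<in> sets N"
  shows "emeasure M {a} * emeasure (f a) B \<le> emeasure (M \<bind> f) B"
proof -
  have "sets (f a) = sets N" by (rule sets_kernel[OF f a(1)])
  moreover have "sets (M \<bind> f) = sets N"
    using sets_bind[of M f N, OF sets_kernel[OF f]] a(1) by blast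
  ultimately show ?thesis
    using nn_integral_bind_ge[OF f a(2) borel_measurable_indicator[OF B]] B by simp
qed

lemma emeasure_return_singleton: "{a} \<in> sets M \<Longrightarrow> emeasure (return M a) {a} = 1"
  by (simp add: emeasure_return)

text \<open>\<open>P\<close> may have mass below \<open>1\<close>, because backward sampling can
  lose mass. If \<open>z\<close> lies in \<open>B\<close>, then \<open>measure P B\<close> is
  between \<open>measure P {z}\<close> and \<open>1\<close>; otherwise \<open>B\<close> must fit
  into the mass that the atom leaves over.\<close>

lemma tv_dist_return:
  assumes "subprob_space P" "sets P = sets S" "z \<in> space S" "{z} \<in> sets S"
  shows "tv_dist P (return S z) \<in> {0..1 - measure P {z}}"
proof -
  interpret subprob_space P by fact
  have le: "\<bar>measure P B - measure (return S z) B\<bar> \<le> 1 - measure P {z}" if B: "B \<in> sets P" for B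
  proof (cases "z \<in> B")
    case True
    then have "measure P {z} \<le> measure P B"
      using B by (intro finite_measure_mono) auto
    then show ?thesis
      using True B assms subprob_measure_le_1[of B] by (auto simp: measure_return)
  next
    case False
    then have "measure P B + measure P {z} = measure P (B \<union> {z})"
      using B assms by (intro finite_measure_Union[symmetric]) auto
    also have "\<dots> \<le> 1" by (rule subprob_measure_le_1)
    finally show ?thesis
      using False B assms by (auto simp: measure_return)
  qed
  have "tv_dist P (return S z) \<le> 1 - measure P {z}"
    unfolding tv_dist_def by (intro cSUP_least le) auto
  \<comment> \<open>A real supremum needs boundedness, which is the estimate \<open>le\<close> once
    more; the empty set contributes the value \<open>0\<close>.\<close>
  moreover have "0 \<le> tv_dist P (return S z)"
    unfolding tv_dist_def
    by (rule cSUP_upper2[where x="{}"]) (auto intro!: bdd_aboveI2[where M="1 - measure P {z}"] le)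
  ultimately show ?thesis by simp
qed

subsection \<open>The weak law of large numbers\<close>

text \<open>Independence is read off from the joint law: applying \<open>f\<close> in each
  coordinate maps the product of copies of \<open>M\<close> to the product of the image
  laws.\<close>

lemma indep_vars_PiM_coordinates:
  fixes f :: "'a \<Rightarrow> 'b :: topological_space"
  assumes "finite I" "prob_space M" "f \<in> borel_measurable M"
  shows "prob_space.indep_vars (PiM I (\<lambda>_. M)) (\<lambda>_. borel) (\<lambda>i y. f (y i)) I"
proof (cases "I = {}")
  case True
  interpret P: prob_space "PiM I (\<lambda>_. M)" using assms by (intro prob_space_PiM)
  show ?thesis unfolding P.indep_vars_def P.indep_sets_def using True by auto
next
  case False
  interpret P: prob_space "PiM I (\<lambda>_. M)" using assms by (intro prob_space_PiM)
  note [measurable] = assms(3)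
  interpret B: prob_space "distr M borel f" using assms by (intro prob_space.prob_space_distr)
  \<comment> \<open>A probability measure with the Borel sets is wanted as target of the image of a
    product measure; \<open>distr\<close> reads only the sets of its target, so any such measure
    serves.\<close>
  define B where "B = return (borel :: 'b measure) undefined"
  have "distr (PiM I (\<lambda>_. M)) (PiM I (\<lambda>_. borel)) (\<lambda>y. \<lambda>i\<in>I. f (y i)) =
        distr (PiM I (\<lambda>_. M)) (PiM I (\<lambda>_. B)) (compose I f)"
    by (intro distr_cong) (auto simp: compose_def B_def intro!: sets_PiM_cong)
  also have "\<dots> = PiM I (\<lambda>_. distr M B f)"
    using assms by (intro distr_PiM_finite_prob_space') (auto simp: B_def prob_space_return)
  also have "\<dots> = PiM I (\<lambda>i. distr (PiM I (\<lambda>_. M)) borel (\<lambda>y. f (y i)))"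
  proof (intro PiM_cong refl)
    fix i assume i: "i \<in> I"
    have "distr M B f = distr M borel f" by (intro distr_cong) (auto simp: B_def)
    also have "\<dots> = distr (distr (PiM I (\<lambda>_. M)) M (\<lambda>y. y i)) borel f"
      using i assms(2) by (subst distr_PiM_component[of I "\<lambda>_. M"]) auto
    also have "\<dots> = distr (PiM I (\<lambda>_. M)) borel (\<lambda>y. f (y i))"
      using i by (subst distr_distr) (auto simp: comp_def)
    finally show "distr M B f = distr (PiM I (\<lambda>_. M)) borel (\<lambda>y. f (y i))" .
  qed
  finally show ?thesis
    using False by (subst P.indep_vars_iff_distr_eq_PiM') auto
qed

lemma
  fixes f :: "'a \<Rightarrow> real"
  assumes "i \<in> I" "prob_space M" "f \<in> borel_measurable M"
  shows integral_PiM_coordinate: "(\<integral>y. f (y i) \<partial>PiM I (\<lambda>_. M)) = (\<integral>x. f x \<partial>M)"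
    and integrable_PiM_coordinate_iff: "integrable (PiM I (\<lambda>_. M)) (\<lambda>y. f (y i)) \<longleftrightarrow> integrable M f"
    and distr_PiM_coordinate: "distr (PiM I (\<lambda>_. M)) borel (\<lambda>y. f (y i)) = distr M borel f"
proof -
  have d: "distr (PiM I (\<lambda>_. M)) M (\<lambda>y. y i) = M"
    using assms by (intro distr_PiM_component[of I "\<lambda>_. M"]) auto
  note [measurable] = assms(3)
  show "(\<integral>y. f (y i) \<partial>PiM I (\<lambda>_. M)) = (\<integral>x. f x \<partial>M)"
    using assms(1) by (subst (2) d[symmetric], subst integral_distr) auto
  show "integrable (PiM I (\<lambda>_. M)) (\<lambda>y. f (y i)) \<longleftrightarrow> integrable M f"
    using assms(1) by (subst (2) d[symmetric], subst integrable_distr_eq) auto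
  show "distr (PiM I (\<lambda>_. M)) borel (\<lambda>y. f (y i)) = distr M borel f"
    using assms(1) by (subst (2) d[symmetric], subst distr_distr) (auto simp: comp_def)
qed

text \<open>Dominated convergence: the error at \<open>x\<close> is eventually \<open>0\<close>,
  once \<open>k\<close> exceeds the absolute value of \<open>f x\<close>. This carries inequalities
  for bounded variables over to integrable ones.\<close>

lemma integral_truncation_error_tendsto_0:
  fixes f :: "'a \<Rightarrow> real"
  assumes "integrable M f"
  shows "(\<lambda>k. \<integral>x. \<bar>f x - max (- real k) (min (real k) (f x))\<bar> \<partial>M) \<longlonglongrightarrow> 0"
proof -
  have "(\<lambda>k. \<integral>x. \<bar>f x - max (- real k) (min (real k) (f x))\<bar> \<partial>M) \<longlonglongrightarrow> (\<integral>x. 0 \<partial>M)"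
  proof (rule integral_dominated_convergence[where w="\<lambda>x. \<bar>f x\<bar>"])
    show "AE x in M. (\<lambda>k. \<bar>f x - max (- real k) (min (real k) (f x))\<bar>) \<longlonglongrightarrow> 0"
    proof (intro AE_I2 tendsto_eventually)
      fix x
      show "\<forall>\<^sub>F k in sequentially. \<bar>f x - max (- real k) (min (real k) (f x))\<bar> = 0"
        using eventually_ge_at_top[of "nat \<lceil>\<bar>f x\<bar>\<rceil>"]
        by eventually_elim (auto simp: nat_le_iff ceiling_le_iff)
    qed
  qed (use assms in \<open>auto simp: integrable_iff_bounded\<close>)
  then show ?thesis by simp
qed

text \<open>After truncation of \<open>\<xi>\<close> at \<open>K\<close>, Hoeffding's inequality
  controls the bounded part and gives the exponential term; Markov's inequality controls the
  accumulated truncation error and gives \<open>\<delta> / a\<close>, uniformly in \<open>D\<close>.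
  The gap \<open>4 * a\<close> pays \<open>a\<close> for the shift of the mean, \<open>a\<close> for
  the deviation of the bounded part and \<open>a\<close> for the errors; the last \<open>a\<close>
  is slack.\<close>

lemma prob_sum_coordinates_le_bound:
  fixes \<xi> :: "'a \<Rightarrow> real" and D K :: nat and a c :: real
  assumes M: "prob_space M" and \<xi>: "integrable M \<xi>" and "a > 0" "K > 0" "D > 0"
    and c: "c + 4 * a \<le> (\<integral>x. \<xi> x \<partial>M)"
    and K: "(\<integral>x. \<bar>\<xi> x - max (- real K) (min (real K) (\<xi> x))\<bar> \<partial>M) \<le> \<delta>" and \<delta>: "\<delta> \<le> a"
  shows "measure (PiM {1..D} (\<lambda>_. M)) {y\<in>space (PiM {1..D} (\<lambda>_. M)). (\<Sum>d=1..D. \<xi> (y d)) \<le> c * real D}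
           \<le> exp (- 2 * D * a\<^sup>2 / (K + K)\<^sup>2) + \<delta> / a"
proof -
  let ?P = "PiM {1..D} (\<lambda>_. M)"
  interpret M: prob_space M by fact
  interpret P: prob_space ?P using M by (intro prob_space_PiM)
  have [measurable]: "\<xi> \<in> borel_measurable M" using \<xi> by auto
  define \<eta> where "\<eta> x = max (- real K) (min (real K) (\<xi> x))" for x
  have [measurable]: "\<eta> \<in> borel_measurable M" by (simp add: \<eta>_def[abs_def])
  have \<eta>_int: "integrable M \<eta>"
    by (rule M.integrable_const_bound[of _ K]) (auto simp: \<eta>_def)
  have dint: "integrable M (\<lambda>x. \<bar>\<xi> x - \<eta> x\<bar>)" using \<xi> \<eta>_int by auto
  have "(\<integral>x. \<xi> x \<partial>M) - (\<integral>x. \<eta> x \<partial>M) = (\<integral>x. \<xi> x - \<eta> x \<partial>M)"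
    using \<xi> \<eta>_int by simp
  also have "\<dots> \<le> (\<integral>x. \<bar>\<xi> x - \<eta> x\<bar> \<partial>M)"
    using \<xi> \<eta>_int by (intro integral_mono) auto
  finally have E\<eta>: "c + 3 * a \<le> (\<integral>x. \<eta> x \<partial>M)"
    using K \<delta> c by (simp add: \<eta>_def)
  \<comment> \<open>The common law is represented by coordinate \<open>1\<close>, which exists
    because \<open>D > 0\<close>.\<close>
  interpret H: Hoeffding_ineq_iid ?P "{1..D}" "\<lambda>d y. \<eta> (y d)" "\<lambda>y. \<eta> (y 1)" "- real K" "real K" "M.expectation \<eta>"
  proof unfold_locales
    show "P.indep_vars (\<lambda>_. borel) (\<lambda>d y. \<eta> (y d)) {1..D}"
      using M by (intro indep_vars_PiM_coordinates) auto
    show "distr ?P borel (\<lambda>y. \<eta> (y i)) = distr ?P borel (\<lambda>y. \<eta> (y 1))" if "i \<in> {1..D}" for i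
      using that M \<open>D > 0\<close> by (simp add: distr_PiM_coordinate)
    show "P.random_variable borel (\<lambda>y. \<eta> (y 1))"
      using \<open>D > 0\<close> by simp
    show "M.expectation \<eta> \<equiv> P.expectation (\<lambda>y. \<eta> (y 1))"
      using M \<open>D > 0\<close> by (simp add: integral_PiM_coordinate)
  qed (auto simp: \<eta>_def)
  let ?A = "{y\<in>space ?P. (\<Sum>d=1..D. \<eta> (y d)) / D \<le> M.expectation \<eta> - a}"
  let ?B = "{y\<in>space ?P. (\<Sum>d=1..D. \<bar>\<xi> (y d) - \<eta> (y d)\<bar>) \<ge> D * a}"
  have A: "measure ?P ?A \<le> exp (- 2 * D * a\<^sup>2 / (K + K)\<^sup>2)"
    using H.Hoeffding_ineq_le'[of a] \<open>a > 0\<close> \<open>K > 0\<close> \<open>D > 0\<close> by simp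
  have "measure ?P ?B \<le> (\<integral>y. (\<Sum>d=1..D. \<bar>\<xi> (y d) - \<eta> (y d)\<bar>) \<partial>?P) / (D * a)"
    using \<open>a > 0\<close> \<open>D > 0\<close> dint M
    by (intro integral_Markov_inequality_measure[where A="{}"] Bochner_Integration.integrable_sum)
       (auto simp: integrable_PiM_coordinate_iff[where f="\<lambda>x. \<bar>\<xi> x - \<eta> x\<bar>"] intro!: sum_nonneg)
  also have "(\<integral>y. (\<Sum>d=1..D. \<bar>\<xi> (y d) - \<eta> (y d)\<bar>) \<partial>?P) = D * (\<integral>x. \<bar>\<xi> x - \<eta> x\<bar> \<partial>M)"
    using dint M
    by (subst Bochner_Integration.integral_sum)
       (auto simp: integrable_PiM_coordinate_iff[where f="\<lambda>x. \<bar>\<xi> x - \<eta> x\<bar>"]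
          integral_PiM_coordinate[where f="\<lambda>x. \<bar>\<xi> x - \<eta> x\<bar>"])
  also have "\<dots> \<le> D * \<delta>" using K by (simp add: \<eta>_def mult_left_mono)
  finally have B: "measure ?P ?B \<le> \<delta> / a"
    using \<open>D > 0\<close> \<open>a > 0\<close> by (simp add: divide_right_mono)
  have "{y\<in>space ?P. (\<Sum>d=1..D. \<xi> (y d)) \<le> c * real D} \<subseteq> ?A \<union> ?B"
  proof (rule subsetI, rule ccontr)
    fix y assume "y \<in> {y\<in>space ?P. (\<Sum>d=1..D. \<xi> (y d)) \<le> c * real D}" "y \<notin> ?A \<union> ?B"
    then have y: "(\<Sum>d=1..D. \<xi> (y d)) \<le> c * D" "\<not> real D * a \<le> (\<Sum>d=1..D. \<bar>\<xi> (y d) - \<eta> (y d)\<bar>)"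
      and n: "\<not> (\<Sum>d=1..D. \<eta> (y d)) / D \<le> M.expectation \<eta> - a"
      by auto
    have "(\<Sum>d=1..D. \<eta> (y d)) - (\<Sum>d=1..D. \<xi> (y d)) \<le> (\<Sum>d=1..D. \<bar>\<xi> (y d) - \<eta> (y d)\<bar>)"
      by (subst sum_subtractf[symmetric], rule sum_mono) auto
    then have "(\<Sum>d=1..D. \<eta> (y d)) \<le> D * (c + a)" using y by (simp add: algebra_simps)
    also have "\<dots> \<le> D * (M.expectation \<eta> - a)"
      using E\<eta> \<open>a > 0\<close> by (intro mult_left_mono) auto
    finally show False using n \<open>D > 0\<close> by (simp add: field_simps)
  qed
  then have "measure ?P {y\<in>space ?P. (\<Sum>d=1..D. \<xi> (y d)) \<le> c * real D} \<le> measure ?P (?A \<union> ?B)"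
    by (rule P.finite_measure_mono) measurable
  also have "\<dots> \<le> measure ?P ?A + measure ?P ?B"
    by (rule measure_Un_le) measurable
  finally show ?thesis using A B by simp
qed

text \<open>The order of choices matters: \<open>K\<close> is fixed first, so that truncation
  contributes at most \<open>r / 2\<close> for every \<open>D\<close>, and only then does
  \<open>D\<close> grow until the Hoeffding term falls below \<open>r / 2\<close>.\<close>

lemma weak_law_lower_tail:
  fixes \<xi> :: "'a \<Rightarrow> real" and c :: real
  assumes M: "prob_space M" and \<xi>: "integrable M \<xi>" and c: "c < (\<integral>x. \<xi> x \<partial>M)"
  shows "(\<lambda>D::nat. measure (PiM {1..D} (\<lambda>_. M))
            {y\<in>space (PiM {1..D} (\<lambda>_. M)). (\<Sum>d=1..D. \<xi> (y d)) \<le> c * real D}) \<longlonglongrightarrow> 0"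
proof (rule tendstoI)
  fix r :: real assume r: "0 < r"
  \<comment> \<open>A quarter of the gap, to meet the budget \<open>4 * a\<close> of the bound;
    \<open>\<delta>\<close> is then small enough for \<open>\<delta> / a\<close> to stay below
    \<open>r / 2\<close>.\<close>
  define a where "a = ((\<integral>x. \<xi> x \<partial>M) - c) / 4"
  define \<delta> where "\<delta> = min a (a * r / 2)"
  have a: "a > 0" "c + 4 * a \<le> (\<integral>x. \<xi> x \<partial>M)" using c by (auto simp: a_def field_simps)
  have \<delta>: "\<delta> > 0" "\<delta> \<le> a" "\<delta> / a \<le> r / 2" using a r by (auto simp: \<delta>_def field_simps min_le_iff_disj)
  have "\<forall>\<^sub>F k in sequentially. (\<integral>x. \<bar>\<xi> x - max (- real k) (min (real k) (\<xi> x))\<bar> \<partial>M) < \<delta>"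
    using integral_truncation_error_tendsto_0[OF \<xi>] \<delta>(1) by (rule order_tendstoD)
  then obtain K where K: "K > 0" "(\<integral>x. \<bar>\<xi> x - max (- real K) (min (real K) (\<xi> x))\<bar> \<partial>M) < \<delta>"
    using eventually_gt_at_top[of "0::nat"] by (metis (mono_tags, lifting) eventually_conj eventually_happens trivial_limit_sequentially)
  have "(\<lambda>D::nat. exp (- (2 * a\<^sup>2 / (real K + real K)\<^sup>2) * real D)) \<longlonglongrightarrow> 0"
    using a K
    by (intro filterlim_compose[OF exp_at_bot] filterlim_tendsto_neg_mult_at_bot[OF tendsto_const]
         filterlim_real_sequentially) auto
  then have "\<forall>\<^sub>F D in sequentially. exp (- (2 * a\<^sup>2 / (real K + real K)\<^sup>2) * real D) < r / 2"
    using r by (intro order_tendstoD) auto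
  then show "eventually (\<lambda>D::nat. dist (measure (PiM {1..D} (\<lambda>_. M))
            {y\<in>space (PiM {1..D} (\<lambda>_. M)). (\<Sum>d=1..D. \<xi> (y d)) \<le> c * real D}) 0 < r) sequentially"
    using eventually_gt_at_top[of 0]
  proof eventually_elim
    case (elim D)
    let ?p = "measure (PiM {1..D} (\<lambda>_. M)) {y\<in>space (PiM {1..D} (\<lambda>_. M)). (\<Sum>d=1..D. \<xi> (y d)) \<le> c * real D}"
    have "?p \<le> exp (- 2 * D * a\<^sup>2 / (real K + real K)\<^sup>2) + \<delta> / a"
      using prob_sum_coordinates_le_bound[OF M \<xi> a(1) K(1) elim(2) a(2) less_imp_le[OF K(2)] \<delta>(2)] by simp
    also have "- 2 * D * a\<^sup>2 / (real K + real K)\<^sup>2 = - (2 * a\<^sup>2 / (real K + real K)\<^sup>2) * real D"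
      by simp
    finally have "?p < r" using elim(1) \<delta>(3) by linarith
    then show ?case by simp
  qed
qed

text \<open>Once the two indices are exchanged, the columns of a random path are independent copies
  of \<open>M\<close>, and a union bound over the finite \<open>\<Xi>\<close> reduces the claim to
  the lower tail of each \<open>\<xi>\<close>. The condition on \<open>\<Omega>\<close> costs no
  mass but makes almost sure properties available at every path in \<open>F D\<close>.\<close>

lemma typical_sets:
  fixes M :: "(nat \<Rightarrow> real) measure" and \<Xi> :: "((nat \<Rightarrow> real) \<Rightarrow> real) set" and c :: real
  assumes M: "prob_space M" and sets_M: "sets M = sets (PiM {1..T} (\<lambda>_. borel))"
    and \<Omega>: "\<Omega> \<in> sets M" "AE y in M. y \<in> \<Omega>"
    and \<Xi>: "finite \<Xi>" "\<And>\<xi>. \<xi> \<in> \<Xi> \<Longrightarrow> integrable M \<xi>" "\<And>\<xi>. \<xi> \<in> \<Xi> \<Longrightarrow> c < (\<integral>y. \<xi> y \<partial>M)"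
  defines "F \<equiv> \<lambda>D. {x \<in> space (path_space T D). (\<forall>d\<in>{1..D}. (\<lambda>t\<in>{1..T}. x t d) \<in> \<Omega>) \<and>
      (\<forall>\<xi>\<in>\<Xi>. c * real D < (\<Sum>d=1..D. \<xi> (\<lambda>t\<in>{1..T}. x t d)))}"
  shows "F D \<in> sets (path_space T D)"
    and "(\<lambda>D. measure (distr (PiM {1..D} (\<lambda>_. M)) (path_space T D)
            (\<lambda>y. \<lambda>t\<in>{1..T}. \<lambda>d\<in>{1..D}. y d t)) (F D)) \<longlonglongrightarrow> 1"
proof -
  have \<xi>_meas: "\<xi> \<in> borel_measurable M" if "\<xi> \<in> \<Xi>" for \<xi> using \<Xi>(2)[OF that] by auto
  have space_M: "space M = space (PiM {1..T} (\<lambda>_. borel))" by (rule sets_eq_imp_space_eq[OF sets_M])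
  have col: "(\<lambda>x. \<lambda>t\<in>{1..T}. x t d) \<in> path_space T D \<rightarrow>\<^sub>M M" if "d \<in> {1..D}" for d D
    unfolding measurable_cong_sets[OF refl sets_M] path_space_def vec_space_def using that
  proof (intro measurable_restrict)
    fix t assume "t \<in> {1..T}"
    then show "(\<lambda>x. x t d) \<in> borel_measurable (PiM {1..T} (\<lambda>_. PiM {1..D} (\<lambda>_. borel :: real measure)))"
      using that by (intro measurable_compose[of "\<lambda>x. x t" _ "PiM {1..D} (\<lambda>_. borel)" "\<lambda>y. y d"]) auto
  qed
  have F_meas: "F D \<in> sets (path_space T D)" for D
  proof -
    have "Measurable.pred (path_space T D) (\<lambda>x. (\<lambda>t\<in>{1..T}. x t d) \<in> \<Omega>)" if "d \<in> {1..D}" for d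
      using col[OF that] \<Omega>(1) by measurable
    moreover have "(\<lambda>x. \<Sum>d=1..D. \<xi> (\<lambda>t\<in>{1..T}. x t d)) \<in> borel_measurable (path_space T D)" if "\<xi> \<in> \<Xi>" for \<xi>
      by (intro borel_measurable_sum measurable_compose[OF col \<xi>_meas[OF that]])
    then have "Measurable.pred (path_space T D) (\<lambda>x. c * real D < (\<Sum>d=1..D. \<xi> (\<lambda>t\<in>{1..T}. x t d)))" if "\<xi> \<in> \<Xi>" for \<xi>
      using that by measurable
    ultimately show ?thesis
      unfolding F_def using \<Xi>(1) by (intro predE pred_intros_logic pred_intros_finite) auto
  qed
  show "F D \<in> sets (path_space T D)" by (rule F_meas)
  let ?P = "\<lambda>D::nat. PiM {1..D} (\<lambda>_. M)"
  let ?bad = "\<lambda>D \<xi>. {y \<in> space (?P D). (\<Sum>d=1..D. \<xi> (y d)) \<le> c * real D}"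
  let ?m = "\<lambda>D. measure (distr (?P D) (path_space T D) (\<lambda>y. \<lambda>t\<in>{1..T}. \<lambda>d\<in>{1..D}. y d t)) (F D)"
  have bounds: "1 - (\<Sum>\<xi>\<in>\<Xi>. measure (?P D) (?bad D \<xi>)) \<le> ?m D \<and> ?m D \<le> 1" for D
  proof -
    interpret P: prob_space "?P D" using M by (intro prob_space_PiM)
    have swap: "(\<lambda>y. \<lambda>t\<in>{1..T}. \<lambda>d\<in>{1..D}. y d t) \<in> ?P D \<rightarrow>\<^sub>M path_space T D"
    proof -
      have "(\<lambda>y. y d t) \<in> borel_measurable (?P D)" if "d \<in> {1..D}" "t \<in> {1..T}" for d t
      proof -
        have "(\<lambda>x. x t) \<in> borel_measurable M"
          unfolding measurable_cong_sets[OF sets_M refl] using that by measurable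
        then show ?thesis using that by (intro measurable_compose[OF measurable_component_singleton])
      qed
      then show ?thesis unfolding path_space_def vec_space_def by (intro measurable_restrict)
    qed
    let ?E = "{y \<in> space (?P D). (\<forall>d\<in>{1..D}. y d \<in> \<Omega>) \<and> (\<forall>\<xi>\<in>\<Xi>. c * real D < (\<Sum>d=1..D. \<xi> (y d)))}"
    let ?B = "\<Union>\<xi>\<in>\<Xi>. ?bad D \<xi>"
    have preimage: "(\<lambda>y. \<lambda>t\<in>{1..T}. \<lambda>d\<in>{1..D}. y d t) -` F D \<inter> space (?P D) = ?E"
    proof -
      let ?s = "\<lambda>y. \<lambda>t\<in>{1..T}. \<lambda>d\<in>{1..D}. y d t"
      have "?s y \<in> F D \<longleftrightarrow> (\<forall>d\<in>{1..D}. y d \<in> \<Omega>) \<and> (\<forall>\<xi>\<in>\<Xi>. c * real D < (\<Sum>d=1..D. \<xi> (y d)))"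
        if y: "y \<in> space (?P D)" for y
      proof -
        \<comment> \<open>Exchanging the indices twice gives back \<open>y d\<close>, because points
          of the product space are extensional.\<close>
        have eq: "(\<lambda>t\<in>{1..T}. ?s y t d) = y d" if "d \<in> {1..D}" for d
          using that y unfolding space_PiM space_M by (auto simp: PiE_iff extensional_def fun_eq_iff)
        have sum1: "(\<Sum>d=1..D. \<xi> (\<lambda>t\<in>{1..T}. ?s y t d)) = (\<Sum>d=1..D. \<xi> (y d))" for \<xi> :: "(nat \<Rightarrow> real) \<Rightarrow> real"
          by (rule sum.cong[OF refl]) (simp only: eq)
        have sum: "(\<forall>\<xi>\<in>\<Xi>. c * real D < (\<Sum>d=1..D. \<xi> (\<lambda>t\<in>{1..T}. ?s y t d))) \<longleftrightarrow>
            (\<forall>\<xi>\<in>\<Xi>. c * real D < (\<Sum>d=1..D. \<xi> (y d)))"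
          by (rule ball_cong[OF refl], rule arg_cong[where f="\<lambda>z. c * real D < z"], rule sum1)
        have "(\<forall>d\<in>{1..D}. (\<lambda>t\<in>{1..T}. ?s y t d) \<in> \<Omega>) \<longleftrightarrow> (\<forall>d\<in>{1..D}. y d \<in> \<Omega>)"
          by (rule ball_cong[OF refl]) (simp only: eq)
        with sum measurable_space[OF swap y] show ?thesis
          unfolding F_def mem_Collect_eq by (iprover intro: iffI conjI elim: iffE conjE)
      qed
      then show ?thesis by blast
    qed
    have m: "?m D = measure (?P D) ?E"
      by (simp only: measure_distr[OF swap F_meas] preimage)
    have E: "?E \<in> sets (?P D)"
      using measurable_sets[OF swap F_meas[of D]] unfolding preimage .
    have bad: "?bad D \<xi> \<in> sets (?P D)" if "\<xi> \<in> \<Xi>" for \<xi>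
      using \<xi>_meas[OF that] by measurable
    have "AE y in ?P D. \<forall>d\<in>{1..D}. y d \<in> \<Omega>"
      using M \<Omega>(2) by (intro AE_finite_allI AE_PiM_component) auto
    \<comment> \<open>Outside the bad sets only membership in \<open>\<Omega>\<close> can fail,
      which is a null event; hence monotonicity up to null sets.\<close>
    then have "AE y in ?P D. y \<in> space (?P D) - ?B \<longrightarrow> y \<in> ?E"
      by eventually_elim (auto simp: not_le)
    then have "measure (?P D) (space (?P D) - ?B) \<le> measure (?P D) ?E"
      by (rule P.finite_measure_mono_AE[OF _ E])
    moreover have "?B \<in> sets (?P D)" using bad \<Xi>(1) by (intro sets.finite_UN) auto
    then have "measure (?P D) (space (?P D) - ?B) = 1 - measure (?P D) ?B" by (rule P.prob_compl)
    moreover have "measure (?P D) ?B \<le> (\<Sum>\<xi>\<in>\<Xi>. measure (?P D) (?bad D \<xi>))"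
      using bad \<Xi>(1) by (intro P.finite_measure_subadditive_finite) auto
    ultimately show ?thesis using m P.prob_le_1[of ?E] by linarith
  qed
  have "(\<lambda>D. 1 - (\<Sum>\<xi>\<in>\<Xi>. measure (?P D) (?bad D \<xi>))) \<longlonglongrightarrow> 1 - (\<Sum>\<xi>\<in>\<Xi>. 0)"
    using weak_law_lower_tail[OF M \<Xi>(2,3)] by (intro tendsto_diff tendsto_const tendsto_sum)
  then have "(\<lambda>D. 1 - (\<Sum>\<xi>\<in>\<Xi>. measure (?P D) (?bad D \<xi>))) \<longlonglongrightarrow> 1" by simp
  then show "?m \<longlonglongrightarrow> 1"
    by (rule tendsto_sandwich[rotated 2, OF _ tendsto_const]) (use bounds in \<open>auto intro!: always_eventually\<close>)
qed

text \<open>The square is \<open>exp (2 * ln N)\<close>, and eventually \<open>ln N\<close> is at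
  most \<open>c / 4 * D\<close>, so half of the exponent \<open>- c * D\<close> survives.\<close>

lemma uniform_dominance_limit:
  fixes T :: nat and c :: real and N :: "nat \<Rightarrow> nat"
  assumes c: "0 < c" and N: "\<And>D. D \<ge> 1 \<Longrightarrow> N D \<ge> 1" and o: "(\<lambda>D. ln (real (N D))) \<in> o(\<lambda>D. real D)"
  shows "(\<lambda>D. 2 * real T * (real (N D))\<^sup>2 * exp (- (c * real D))) \<longlonglongrightarrow> 0"
proof (rule tendsto_sandwich[of "\<lambda>_. 0" _ _ "\<lambda>D. 2 * real T * exp (- (c / 2) * real D)"])
  have "\<forall>\<^sub>F D in sequentially. norm (ln (real (N D))) \<le> c / 4 * norm (real D)"
    using c by (intro landau_o.smallD[OF o]) auto
  then show "\<forall>\<^sub>F D in sequentially. 2 * real T * (real (N D))\<^sup>2 * exp (- (c * real D)) \<le> 2 * real T * exp (- (c / 2) * real D)"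
    using eventually_ge_at_top[of 1]
  proof eventually_elim
    case (elim D)
    then have "0 < real (N D)" using N[of D] by simp
    then have "(real (N D))\<^sup>2 = exp (2 * ln (real (N D)))"
      by (simp only: mult_2 exp_add exp_ln power2_eq_square)
    then have "(real (N D))\<^sup>2 * exp (- (c * real D)) = exp (2 * ln (real (N D)) - c * real D)"
      by (simp only: exp_add[symmetric] diff_conv_add_uminus)
    also have "\<dots> \<le> exp (- (c / 2) * real D)"
      using elim(1) by simp
    finally have "2 * real T * ((real (N D))\<^sup>2 * exp (- (c * real D))) \<le> 2 * real T * exp (- (c / 2) * real D)"
      by (rule mult_left_mono) simp
    then show ?case by (simp only: mult.assoc)
  qed
  have "(\<lambda>D::nat. exp (- (c / 2) * real D)) \<longlonglongrightarrow> 0"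
    using c by (intro filterlim_compose[OF exp_at_bot] filterlim_tendsto_neg_mult_at_bot[OF tendsto_const]
         filterlim_real_sequentially) auto
  from tendsto_mult[OF tendsto_const[of "2 * real T"] this]
  show "(\<lambda>D. 2 * real T * exp (- (c / 2) * real D)) \<longlonglongrightarrow> 0" by simp
qed auto

subsection \<open>Index laws\<close>

lemma space_index_law [simp]: "space (index_law N p) = {0..N}"
  by (simp add: index_law_def)

lemma sets_index_law [simp, measurable_cong]: "sets (index_law N p) = sets (index_space N)"
  by (simp add: index_law_def)

lemma emeasure_index_law: "A \<subseteq> {0..N} \<Longrightarrow> emeasure (index_law N p) A = (\<Sum>k\<in>A. ennreal (p k))"
  unfolding index_law_def
  by (subst emeasure_density)
    (auto simp: nn_integral_count_space_indicator[symmetric] nn_integral_count_space_finite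
       Int_absorb1 sum.inter_restrict[symmetric] indicator_def if_distrib finite_subset cong: if_cong
       intro!: sum.mono_neutral_cong_right)

lemma measurable_index_law:
  assumes "\<And>k. k \<le> N \<Longrightarrow> (\<lambda>x. p x k) \<in> borel_measurable X"
    and "\<And>x. x \<in> space X \<Longrightarrow> (\<Sum>k=0..N. ennreal (p x k)) \<le> 1"
  shows "(\<lambda>x. index_law N (p x)) \<in> X \<rightarrow>\<^sub>M subprob_algebra (index_space N)"
proof (rule measurable_subprob_algebra)
  fix x assume "x \<in> space X"
  then show "subprob_space (index_law N (p x))"
    using assms(2)[of x] by (intro subprob_spaceI) (auto simp: emeasure_index_law)
next
  fix A assume "A \<in> sets (index_space N)"
  moreover from this have "(\<lambda>x. \<Sum>k\<in>A. ennreal (p x k)) \<in> borel_measurable X"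
    using assms(1) by (intro borel_measurable_sum measurable_compose[OF _ measurable_ennreal]) auto
  ultimately show "(\<lambda>x. emeasure (index_law N (p x)) A) \<in> borel_measurable X"
    by (auto simp: emeasure_index_law)
qed simp

lemma sum_normalised_weights:
  fixes w :: "nat \<Rightarrow> real"
  assumes "\<And>k. k \<le> N \<Longrightarrow> 0 \<le> w k"
  shows "(\<Sum>k=0..N. ennreal (w k / (\<Sum>l=0..N. w l))) = (if (\<Sum>l=0..N. w l) = 0 then 0 else 1)"
proof -
  have "(\<Sum>k=0..N. ennreal (w k / (\<Sum>l=0..N. w l))) = ennreal (\<Sum>k=0..N. w k / (\<Sum>l=0..N. w l))"
    using assms by (intro sum_ennreal) (auto intro!: divide_nonneg_nonneg sum_nonneg)
  then show ?thesis
    by (simp add: sum_divide_distrib[symmetric])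
qed

text \<open>Where all weights vanish the law is null, by \<open>0 / 0 = 0\<close>, so the kernel is
  in general only a subprobability kernel. Positive weights, as in resampling, make it a probability
  kernel.\<close>

lemma measurable_weighted_index_law:
  assumes "\<And>k. k \<le> N \<Longrightarrow> (\<lambda>x. w x k) \<in> borel_measurable X"
    and "\<And>x k. x \<in> space X \<Longrightarrow> k \<le> N \<Longrightarrow> 0 \<le> w x k"
  shows "(\<lambda>x. weighted_index_law N (w x)) \<in> X \<rightarrow>\<^sub>M subprob_algebra (index_space N)"
  unfolding weighted_index_law_def using assms
  by (intro measurable_index_law borel_measurable_divide borel_measurable_sum)
    (auto simp: sum_normalised_weights)

lemma prob_space_weighted_index_law:
  assumes "\<And>k. k \<le> N \<Longrightarrow> 0 < w k"
  shows "prob_space (weighted_index_law N w)"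
proof (rule prob_spaceI)
  have "0 < (\<Sum>l=0..N. w l)" using assms by (intro sum_pos) auto
  then show "emeasure (weighted_index_law N w) (space (weighted_index_law N w)) = 1"
    using assms unfolding weighted_index_law_def
    by (auto simp: emeasure_index_law sum_normalised_weights less_imp_le)
qed

lemma emeasure_weighted_index_law_0:
  "emeasure (weighted_index_law N w) {0} = ennreal (w 0 / (\<Sum>l=0..N. w l))"
  by (simp add: weighted_index_law_def emeasure_index_law)

text \<open>For \<open>Phi\<close> the point is that index \<open>0\<close> keeps nonnegative mass:
  the term \<open>1 - min 1 (exp (h n))\<close> only enlarges the denominator beyond the sum of the
  weights, so the masses of \<open>1..N\<close> add up to at most \<open>1\<close>.\<close>

lemma selection_nonneg_sum_le:
  fixes fm :: bool and h :: "nat \<Rightarrow> real" and N :: nat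
  defines "S \<equiv> (if fm then Phi else Psi) N h"
  shows "0 \<le> S n" and "(\<Sum>k=0..N. S k) = 1"
proof -
  define p where "p n = exp (h n) / (1 - min 1 (exp (h n)) + (\<Sum>k = 1..N. exp (h k)))" for n
  have s: "0 \<le> (\<Sum>k = 1..N. exp (h k))" by (intro sum_nonneg) auto
  have p: "0 \<le> p n" for n
    unfolding p_def using s by (intro divide_nonneg_nonneg) auto
  have "(\<Sum>n = 1..N. p n) \<le> (\<Sum>n = 1..N. exp (h n) / (\<Sum>k = 1..N. exp (h k)))"
    unfolding p_def
    by (intro sum_mono divide_left_mono mult_pos_pos add_nonneg_pos sum_pos) auto
  also have "\<dots> \<le> 1" by (simp add: sum_divide_distrib[symmetric])
  finally have p1: "(\<Sum>n = 1..N. p n) \<le> 1" .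
  have Phi: "Phi N h n = (if n = 0 then 1 - (\<Sum>n = 1..N. p n) else p n)" for n
    by (simp add: Phi_def p_def Let_def)
  have split: "(\<Sum>k=0..N. f k) = f 0 + (\<Sum>k=1..N. f k)" for f :: "nat \<Rightarrow> real"
    by (simp add: sum.atLeast_Suc_atMost)
  show "0 \<le> S n"
    using p p1 s by (auto simp: S_def Phi Psi_def)
  show "(\<Sum>k=0..N. S k) = 1"
  proof (cases fm)
    case True
    then show ?thesis by (simp add: S_def split Phi del: sum.cl_ivl_Suc)
  next
    case False
    have "(\<Sum>k=1..N. Psi N h k) = (\<Sum>k=1..N. exp (h k)) / (1 + (\<Sum>k=1..N. exp (h k)))"
      unfolding Psi_def sum_divide_distrib by (intro sum.cong) auto
    then show ?thesis using False s
      by (simp add: S_def split Psi_def add_divide_distrib[symmetric] del: sum.cl_ivl_Suc)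
  qed
qed

lemma measurable_selection:
  assumes "\<And>k. k \<le> N \<Longrightarrow> (\<lambda>x. h x k) \<in> borel_measurable X" "k \<le> N"
  shows "(\<lambda>x. (if fm then Phi else Psi) N (h x) k) \<in> borel_measurable X"
proof -
  have [measurable]: "(\<lambda>x. h x k) \<in> borel_measurable X" if "k \<in> {1..N}" for k
    using assms that by auto
  show ?thesis
    using assms(2) by (cases "k = 0"; cases fm) (simp_all add: Psi_def Phi_def Let_def)
qed

text \<open>The estimates concern atoms at all-zero configurations and at the reference state, so
  these points must be measurable; an extensional point is a box of singletons.\<close>

lemma singleton_in_sets_PiM:
  assumes "finite I" "\<And>i. i \<in> I \<Longrightarrow> {a i} \<in> sets (M i)" "a \<in> extensional I"
  shows "{a} \<in> sets (PiM I M)"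
  using sets_PiM_I_finite[of I "\<lambda>i. {a i}" M] assms by (simp add: PiE_singleton)

lemma singleton_in_sets_vec_space: "v \<in> space (vec_space D) \<Longrightarrow> {v} \<in> sets (vec_space D)"
  unfolding vec_space_def by (intro singleton_in_sets_PiM) (auto simp: space_PiM PiE_iff)

lemma singleton_in_sets_ancestor_space: "{\<lambda>n\<in>{0..N}. 0} \<in> sets (ancestor_space N)"
  unfolding ancestor_space_def by (intro singleton_in_sets_PiM) auto

lemma sets_weighted_index_law [simp]: "sets (weighted_index_law N w) = sets (index_space N)"
  by (simp add: weighted_index_law_def)

definition zero_ancestors :: "nat \<Rightarrow> nat \<Rightarrow> nat \<Rightarrow> nat \<Rightarrow> nat" where
  "zero_ancestors N t = (\<lambda>s\<in>{1..<t}. \<lambda>n\<in>{0..N}. 0)"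

lemma singleton_zero_ancestors: "{zero_ancestors N t} \<in> sets (PiM {1..<t} (\<lambda>_. ancestor_space N))"
  unfolding zero_ancestors_def
  by (intro singleton_in_sets_PiM) (auto simp: singleton_in_sets_ancestor_space)

lemma zero_ancestors_upd:
  assumes "t \<ge> 1"
  shows "(zero_ancestors N t)(t := \<lambda>n\<in>{0..N}. 0) = zero_ancestors N (Suc t)"
  using assms by (auto simp: zero_ancestors_def fun_eq_iff)

text \<open>Both factors are at most \<open>1\<close>, so \<open>(1 - p) * (1 - q)\<close> is
  nonnegative and \<open>p * q\<close> is at least \<open>p + q - 1\<close>; Bernoulli's inequality
  handles \<open>q\<close>. In the application \<open>a\<close> is the total relative weight of the
  free particles in resampling, where \<open>N\<close> ancestors must choose \<open>0\<close>, and
  \<open>b\<close> the one in backward sampling.\<close>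

lemma inverse_one_plus_power_ge:
  fixes a b :: real
  assumes "0 \<le> a" "0 \<le> b"
  shows "1 - real N * a - b \<le> 1 / (1 + b) * (1 / (1 + a)) ^ N"
proof -
  define p q where "p = 1 / (1 + b)" and "q = (1 / (1 + a)) ^ N"
  have p: "1 - b \<le> p" "p \<le> 1" using assms by (auto simp: p_def field_simps)
  have "1 + real N * (- (a / (1 + a))) \<le> (1 + - (a / (1 + a))) ^ N"
    using assms by (intro Bernoulli_inequality) (auto simp: field_simps)
  also have "1 + - (a / (1 + a)) = 1 / (1 + a)" using assms by (simp add: field_simps)
  finally have "1 - real N * (a / (1 + a)) \<le> q" by (simp add: q_def)
  moreover have "real N * (a / (1 + a)) \<le> real N * a"
    using assms by (intro mult_left_mono) (auto simp: field_simps)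
  ultimately have q: "1 - real N * a \<le> q" by simp
  have "q \<le> 1" using assms by (auto simp: q_def intro!: power_le_one)
  then have "0 \<le> (1 - p) * (1 - q)" using p by (intro mult_nonneg_nonneg) auto
  then show ?thesis using p q by (simp add: algebra_simps flip: p_def q_def)
qed

text \<open>One bound covers both selection rules. \<open>Psi\<close> gives
  \<open>1 / (1 + s)\<close>, where \<open>s\<close> is the sum of the weights. For
  \<open>Phi\<close> the denominator of \<open>n\<close> is at least \<open>1\<close>, since
  \<open>s\<close> dominates \<open>exp (h n)\<close>, so index \<open>n\<close> takes at most
  \<open>exp (h n)\<close>.\<close>

lemma selection_0_ge:
  fixes fm :: bool and h :: "nat \<Rightarrow> real"
  shows "1 - (\<Sum>n=1..N. exp (h n)) \<le> (if fm then Phi else Psi) N h 0"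
proof -
  define s where "s = (\<Sum>k = 1..N. exp (h k))"
  have s: "0 \<le> s" unfolding s_def by (intro sum_nonneg) auto
  show ?thesis
  proof (cases fm)
    case False
    then show ?thesis using s by (simp add: Psi_def field_simps s_def[symmetric] del: One_nat_def)
  next
    case True
    have "exp (h n) / (1 - min 1 (exp (h n)) + s) \<le> exp (h n)" if "n \<in> {1..N}" for n
    proof -
      have "exp (h n) \<le> s" unfolding s_def using that by (intro member_le_sum) auto
      then have "1 \<le> 1 - min 1 (exp (h n)) + s" by auto
      then have "exp (h n) / (1 - min 1 (exp (h n)) + s) \<le> exp (h n) / 1"
        by (intro divide_left_mono) auto
      then show ?thesis by simp
    qed
    then have "(\<Sum>n=1..N. exp (h n) / (1 - min 1 (exp (h n)) + s)) \<le> (\<Sum>n=1..N. exp (h n))"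
      by (rule sum_mono)
    then show ?thesis using True by (simp add: Phi_def Let_def s_def[symmetric] del: One_nat_def)
  qed
qed

text \<open>The random index takes finitely many values, and for each of them a fixed coordinate is
  evaluated.\<close>

lemma measurable_select:
  assumes "f \<in> X \<rightarrow>\<^sub>M PiM {0..N} (\<lambda>_. M)" "k \<in> X \<rightarrow>\<^sub>M index_space N"
  shows "(\<lambda>x. f x (k x)) \<in> X \<rightarrow>\<^sub>M M"
  using assms(2)
  by (intro measurable_compose_countable'[where I="{0..N}" and f="\<lambda>i x. f x i" and g=k]
      measurable_compose[OF assms(1) measurable_component_singleton]) auto

lemma relative_weight_0:
  fixes v :: "nat \<Rightarrow> real"
  assumes "0 < v 0"
  shows "v 0 / (\<Sum>l=0..N. v l) = 1 / (1 + (\<Sum>l=1..N. v l / v 0))"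
proof -
  have "(\<Sum>l=0..N. v l) = v 0 * (1 + (\<Sum>l=1..N. v l / v 0))"
    using assms by (simp add: sum.atLeast_Suc_atMost distrib_left sum_distrib_left)
  then show ?thesis using assms by simp
qed

lemma singleton_zero_indices: "{\<lambda>s\<in>{1..T::nat}. 0} \<in> sets (PiM {1..T} (\<lambda>_. index_space N))"
  by (intro singleton_in_sets_PiM) auto

lemma sets_zero_indices:
  "{(zero_ancestors N T, \<lambda>s\<in>{1..T}. 0)} \<in> sets (indices_space N T)"
  using pair_measureI[OF singleton_zero_ancestors[of N T] singleton_zero_indices[of T N]]
  by (simp add: indices_space_def)

text \<open>An equality for \<open>a > 0\<close>. At \<open>a = 0\<close> the convention
  \<open>ln 0 = 0\<close> still leaves an inequality, which spares a proof that the integrals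
  \<open>Mop\<close> are positive.\<close>

lemma ratio_le_exp_ln_diff:
  fixes a b :: real
  assumes "0 \<le> a" "0 < b"
  shows "a / b \<le> exp (- (ln b - ln a))"
proof (cases "a = 0")
  case False
  then show ?thesis using assms by (simp add: exp_diff)
qed simp

lemma prod_mono_ennreal:
  fixes f g :: "'i \<Rightarrow> ennreal"
  assumes "\<And>i. i \<in> A \<Longrightarrow> f i \<le> g i"
  shows "prod f A \<le> prod g A"
  using assms by (induction A rule: infinite_finite_induct) (auto intro!: mult_mono)

text \<open>The hypothesis avoids truncated subtraction in \<open>ennreal\<close>. Bernoulli's
  inequality is used for \<open>\<delta> \<le> 1\<close>; beyond that, for nonempty
  \<open>S\<close>, the left side is \<open>ennreal\<close> of a nonpositive number, hence
  \<open>0\<close>.\<close>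

lemma power_ge_of_one_le_add:
  fixes I :: "'i \<Rightarrow> ennreal" and \<delta> :: real
  assumes "finite S" "\<And>i. i \<in> S \<Longrightarrow> 1 \<le> I i + ennreal \<delta>" "0 \<le> \<delta>"
  shows "ennreal (1 - card S * \<delta>) \<le> (\<Prod>i\<in>S. I i)"
proof (cases "S = {}")
  case False
  then have card: "1 \<le> card S" using assms(1) by (simp add: Suc_le_eq card_gt_0_iff)
  show ?thesis
  proof (cases "\<delta> \<le> 1")
    case True
    have le: "ennreal (1 - \<delta>) \<le> I i" if "i \<in> S" for i
      using assms(2)[OF that] assms(3)
      by (cases "I i") (auto simp: ennreal_plus[symmetric] ennreal_1[symmetric] simp del: ennreal_plus ennreal_1)
    have "1 + real (card S) * (- \<delta>) \<le> (1 + - \<delta>) ^ card S"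
      using True by (intro Bernoulli_inequality) auto
    then have "ennreal (1 - card S * \<delta>) \<le> ennreal ((1 - \<delta>) ^ card S)"
      by (intro ennreal_leI) simp
    also have "\<dots> = (\<Prod>i\<in>S. ennreal (1 - \<delta>))"
      using True by (simp add: ennreal_power)
    also have "\<dots> \<le> (\<Prod>i\<in>S. I i)"
      by (rule prod_mono_ennreal, rule le)
    finally show ?thesis .
  next
    case False
    then have "1 * 1 \<le> real (card S) * \<delta>" using card by (intro mult_mono) auto
    then show ?thesis by (simp add: ennreal_neg)
  qed
qed simp

subsection \<open>Measurability of the i-CSMC kernels\<close>

context feynman_kac_model
begin

lemma Gvec_pos: "t \<ge> 1 \<Longrightarrow> 0 < Gvec G D t z"
  by (auto simp: Gvec_def G_pos intro!: prod_pos)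

lemma mvec_nonneg: "t \<ge> 1 \<Longrightarrow> 0 \<le> mvec m D t x y"
  by (auto simp: mvec_def m_nonneg intro!: prod_nonneg)

lemma measurable_Gvec [measurable]:
  assumes "t \<ge> 1" shows "Gvec G D t \<in> borel_measurable (vec_space D)"
  unfolding Gvec_def vec_space_def using G_measurable[OF assms] by measurable

lemma measurable_mvec:
  assumes "t \<ge> 1" "f \<in> X \<rightarrow>\<^sub>M vec_space D" "g \<in> X \<rightarrow>\<^sub>M vec_space D"
  shows "(\<lambda>x. mvec m D t (f x) (g x)) \<in> borel_measurable X"
  unfolding mvec_def
proof (rule borel_measurable_prod)
  fix d assume "d \<in> {1..D}"
  then have "(\<lambda>x. f x d) \<in> borel_measurable X" "(\<lambda>x. g x d) \<in> borel_measurable X"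
    using assms(2,3) unfolding vec_space_def
    by (auto intro: measurable_compose[OF _ measurable_component_singleton])
  then have "(\<lambda>x. (f x d, g x d)) \<in> X \<rightarrow>\<^sub>M borel \<Otimes>\<^sub>M borel" by measurable
  from measurable_compose[OF this m_measurable[OF assms(1)]]
  show "(\<lambda>x. m t (f x d) (g x d)) \<in> borel_measurable X" by simp
qed

lemma measurable_density_section:
  assumes "t \<ge> 1" shows "m t x \<in> borel_measurable borel"
  using measurable_compose[OF measurable_Pair1' m_measurable[OF assms]] by auto

lemma prob_space_Mker: "t \<ge> 1 \<Longrightarrow> prob_space (Mker m t x)"
  using m_prob measurable_density_section
  by (intro prob_spaceI) (auto simp: Mker_def emeasure_density cong: nn_integral_cong)

lemma sets_Mker [simp, measurable_cong]: "sets (Mker m t x) = sets borel"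
  by (simp add: Mker_def)

lemma measurable_Mker:
  assumes t: "t \<ge> 1" shows "Mker m t \<in> borel \<rightarrow>\<^sub>M prob_algebra borel"
proof (intro measurable_prob_algebraI measurable_subprob_algebra)
  fix A :: "real set" assume A [measurable]: "A \<in> sets borel"
  note m_measurable[OF t, measurable]
  have [measurable]: "m t x \<in> borel_measurable borel" for x
    using t by (rule measurable_density_section)
  have "(\<lambda>x. \<integral>\<^sup>+y. ennreal (m t x y) * indicator A y \<partial>lborel) \<in> borel_measurable borel"
    by (rule lborel.borel_measurable_nn_integral) measurable
  then show "(\<lambda>x. emeasure (Mker m t x) A) \<in> borel_measurable borel"
    by (simp add: Mker_def emeasure_density)
qed (use prob_space_Mker[OF t] prob_space_imp_subprob_space in auto)

lemma measurable_Mvec: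
  assumes "t \<ge> 1" shows "Mvec m D t \<in> vec_space D \<rightarrow>\<^sub>M prob_algebra (vec_space D)"
  unfolding Mvec_def[abs_def] vec_space_def
  by (intro measurable_PiM_kernel measurable_compose[OF _ measurable_Mker[OF assms]]) auto

lemma measurable_mutate:
  assumes "t \<ge> 1" "xt \<in> space (vec_space D)"
    and "\<And>n. n \<in> {0..N} \<Longrightarrow> (\<lambda>x. par x n) \<in> X \<rightarrow>\<^sub>M vec_space D"
  shows "(\<lambda>x. mutate m N D t xt (par x)) \<in> X \<rightarrow>\<^sub>M prob_algebra (particle_space N D)"
  unfolding mutate_def particle_space_def
proof (rule measurable_PiM_kernel)
  fix n assume "n \<in> {0..N}"
  then show "(\<lambda>x. if n = 0 then return (vec_space D) xt else Mvec m D t (par x n))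
      \<in> X \<rightarrow>\<^sub>M prob_algebra (vec_space D)"
    using assms(2) measurable_compose[OF assms(3) measurable_Mvec[OF assms(1)]]
    by (cases "n = 0") (auto simp: space_prob_algebra prob_space_return intro!: measurable_const)
qed simp

lemma measurable_resample:
  assumes t: "t \<ge> 1"
  shows "resample G N D t \<in> particle_space N D \<rightarrow>\<^sub>M prob_algebra (ancestor_space N)"
  unfolding resample_def[abs_def] ancestor_space_def
proof (rule measurable_PiM_kernel)
  fix n assume "n \<in> {0..N}"
  have "(\<lambda>z. weighted_index_law N (\<lambda>l. Gvec G D t (z l))) \<in> particle_space N D \<rightarrow>\<^sub>M prob_algebra (index_space N)"
    using t unfolding particle_space_def
    by (intro measurable_prob_algebraI measurable_weighted_index_law prob_space_weighted_index_law
        measurable_compose[OF _ measurable_Gvec] measurable_component_singleton)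
      (auto simp: Gvec_pos less_imp_le)
  then show "(\<lambda>z. if n = 0 then return (index_space N) 0 else weighted_index_law N (\<lambda>l. Gvec G D t (z l)))
      \<in> particle_space N D \<rightarrow>\<^sub>M prob_algebra (index_space N)"
    by (auto simp: space_prob_algebra prob_space_return intro!: measurable_const)
qed simp

lemma measurable_final_index_law:
  assumes t: "t \<ge> 1"
  shows "final_index_law fm G N D t \<in> particle_space N D \<rightarrow>\<^sub>M subprob_algebra (index_space N)"
  unfolding final_index_law_def[abs_def]
proof (rule measurable_index_law)
  fix k assume k: "k \<le> N"
  have "(\<lambda>z. Gvec G D t (z k)) \<in> borel_measurable (particle_space N D)" if "k \<le> N" for k
    using that t unfolding particle_space_def
    by (intro measurable_compose[OF _ measurable_Gvec] measurable_component_singleton) auto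
  then show "(\<lambda>x. (if fm then Phi else Psi) N (\<lambda>n. ln (Gvec G D t (x n)) - ln (Gvec G D t (x 0))) k)
      \<in> borel_measurable (particle_space N D)"
    using k by (intro measurable_selection borel_measurable_diff borel_measurable_ln) auto
next
  fix z
  show "(\<Sum>k=0..N. ennreal ((if fm then Phi else Psi) N (\<lambda>n. ln (Gvec G D t (z n)) - ln (Gvec G D t (z 0))) k)) \<le> 1"
    by (subst sum_ennreal) (simp_all only: selection_nonneg_sum_le ennreal_1 order_refl)
qed

lemma measurable_backward_weight_law:
  assumes "t \<ge> 1" "f \<in> X \<rightarrow>\<^sub>M particle_space N D" "g \<in> X \<rightarrow>\<^sub>M vec_space D"
  shows "(\<lambda>x. weighted_index_law N (\<lambda>k. Gvec G D t (f x k) * mvec m D (t + 1) (f x k) (g x)))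
      \<in> X \<rightarrow>\<^sub>M subprob_algebra (index_space N)"
proof (rule measurable_weighted_index_law)
  fix k assume "k \<le> N"
  then have "(\<lambda>x. f x k) \<in> X \<rightarrow>\<^sub>M vec_space D"
    using measurable_compose[OF assms(2)[unfolded particle_space_def] measurable_component_singleton[of k]] by auto
  then show "(\<lambda>x. Gvec G D t (f x k) * mvec m D (t + 1) (f x k) (g x)) \<in> borel_measurable X"
    using assms by (intro borel_measurable_times measurable_mvec measurable_compose[OF _ measurable_Gvec]) auto
next
  fix x k
  show "0 \<le> Gvec G D t (f x k) * mvec m D (t + 1) (f x k) (g x)"
    using assms Gvec_pos[of t D "f x k"] by (intro mult_nonneg_nonneg mvec_nonneg) (auto simp: less_imp_le)
qed

lemma measurable_forward_Z:
  assumes "s \<in> {1..t}"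
  shows "(\<lambda>w. fst w s) \<in> forward_space N D t \<rightarrow>\<^sub>M particle_space N D"
  unfolding forward_space_def using assms by measurable

lemma measurable_forward_A:
  assumes "s \<in> {1..<t}"
  shows "(\<lambda>w. snd w s) \<in> forward_space N D t \<rightarrow>\<^sub>M ancestor_space N"
  unfolding forward_space_def using assms by measurable

text \<open>The recursion of \<open>forward_law\<close> from time \<open>1\<close> on, as one kernel
  in the pair \<open>w\<close> of particles and ancestors; projections replace the pattern match so
  that measurability facts compose.\<close>

definition forward_step where
  "forward_step N D xt t w =
     resample G N D t (fst w t) \<bind> (\<lambda>a.
     mutate m N D (Suc t) xt (\<lambda>n. fst w t (a n)) \<bind> (\<lambda>z.
     return (forward_space N D (Suc t)) ((fst w)(Suc t := z), (snd w)(t := a))))"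

lemma forward_law_Suc:
  "t \<ge> 1 \<Longrightarrow> forward_law m G N D x (Suc t) = forward_law m G N D x t \<bind> forward_step N D (x (Suc t)) t"
  by (simp add: forward_step_def[abs_def] case_prod_beta')

lemma measurable_forward_mutate:
  assumes "t \<ge> 1" "xt \<in> space (vec_space D)"
  shows "(\<lambda>(w, a). mutate m N D (Suc t) xt (\<lambda>n. fst w t (a n)))
      \<in> forward_space N D t \<Otimes>\<^sub>M ancestor_space N \<rightarrow>\<^sub>M prob_algebra (particle_space N D)"
  unfolding case_prod_beta'
proof (rule measurable_mutate)
  fix n assume n: "n \<in> {0..N}"
  have "(\<lambda>p. fst (fst p) t) \<in> forward_space N D t \<Otimes>\<^sub>M ancestor_space N \<rightarrow>\<^sub>M particle_space N D"
    using assms by (intro measurable_compose[OF measurable_fst measurable_forward_Z]) auto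
  then have "(\<lambda>p. fst (fst p) t) \<in> forward_space N D t \<Otimes>\<^sub>M ancestor_space N \<rightarrow>\<^sub>M PiM {0..N} (\<lambda>_. vec_space D)"
    by (simp add: particle_space_def)
  moreover have "(\<lambda>p. snd p n) \<in> forward_space N D t \<Otimes>\<^sub>M ancestor_space N \<rightarrow>\<^sub>M index_space N"
    using n unfolding ancestor_space_def by measurable
  ultimately show "(\<lambda>p. fst (fst p) t (snd p n)) \<in> forward_space N D t \<Otimes>\<^sub>M ancestor_space N \<rightarrow>\<^sub>M vec_space D"
    by (rule measurable_select)
qed (use assms in auto)

text \<open>Ancestors lag one time behind particles: the particle history grows from
  \<open>{1..t}\<close> by \<open>Suc t\<close>, the ancestor history from \<open>{1..<t}\<close> by
  \<open>t\<close>.\<close>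

lemma measurable_forward_append:
  "(\<lambda>((w, a), z). ((fst w)(Suc t := z), (snd w)(t := a)))
      \<in> (forward_space N D t \<Otimes>\<^sub>M ancestor_space N) \<Otimes>\<^sub>M particle_space N D \<rightarrow>\<^sub>M forward_space N D (Suc t)"
  if "t \<ge> 1"
  unfolding forward_space_def case_prod_beta' using that
  by (intro measurable_Pair measurable_fun_upd[where J="{1..t}"] measurable_fun_upd[where J="{1..<t}"]) auto

lemma measurable_forward_step:
  assumes "t \<ge> 1" "xt \<in> space (vec_space D)"
  shows "forward_step N D xt t \<in> forward_space N D t \<rightarrow>\<^sub>M prob_algebra (forward_space N D (Suc t))"
    and "(\<lambda>(w, a). mutate m N D (Suc t) xt (\<lambda>n. fst w t (a n)) \<bind> (\<lambda>z.
     return (forward_space N D (Suc t)) ((fst w)(Suc t := z), (snd w)(t := a))))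
       \<in> forward_space N D t \<Otimes>\<^sub>M ancestor_space N \<rightarrow>\<^sub>M prob_algebra (forward_space N D (Suc t))"
proof -
  show *: "(\<lambda>(w, a). mutate m N D (Suc t) xt (\<lambda>n. fst w t (a n)) \<bind> (\<lambda>z.
     return (forward_space N D (Suc t)) ((fst w)(Suc t := z), (snd w)(t := a))))
       \<in> forward_space N D t \<Otimes>\<^sub>M ancestor_space N \<rightarrow>\<^sub>M prob_algebra (forward_space N D (Suc t))"
    unfolding case_prod_beta'
    using measurable_forward_mutate[OF assms, unfolded case_prod_beta']
      measurable_compose[OF measurable_forward_append[OF assms(1)] measurable_return_prob_space]
    by (intro measurable_bind_prob_space2[where N="particle_space N D"]) (auto simp: case_prod_beta')
  show "forward_step N D xt t \<in> forward_space N D t \<rightarrow>\<^sub>M prob_algebra (forward_space N D (Suc t))"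
    unfolding forward_step_def[abs_def]
    using assms * by (intro measurable_bind_prob_space2[where N="ancestor_space N"]
        measurable_compose[OF measurable_forward_Z measurable_resample]) auto
qed

lemma measurable_forward_start:
  "(\<lambda>z. ((\<lambda>_. undefined)(1 := z), \<lambda>_. undefined)) \<in> particle_space N D \<rightarrow>\<^sub>M forward_space N D 1"
  unfolding forward_space_def
  by (intro measurable_Pair measurable_fun_upd[where J="{}"] measurable_const) (auto simp: space_PiM)

lemma mutate_in_prob_algebra:
  assumes "t \<ge> 1" "xt \<in> space (vec_space D)" "\<And>n. n \<in> {0..N} \<Longrightarrow> par n \<in> space (vec_space D)"
  shows "mutate m N D t xt par \<in> space (prob_algebra (particle_space N D))"
  using measurable_space[OF measurable_mutate[where X="count_space UNIV" and par="\<lambda>_. par"], of t xt D N undefined]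
    assms by auto

text \<open>At time \<open>1\<close> the kernel ignores its argument. The dummy parent
  \<open>\<lambda>_ _. 0\<close> need not consist of points of \<open>vec_space D\<close>, which are
  extensional; this allows a genuine point to take its place.\<close>

lemma mutate_initial: "mutate m N D 1 xt par = mutate m N D 1 xt par'"
  using m_initial unfolding mutate_def Mvec_def Mker_def
  by (intro PiM_cong refl if_cong) (metis (no_types, lifting))

lemma mutate_initial_in_prob_algebra:
  assumes "xt \<in> space (vec_space D)"
  shows "mutate m N D 1 xt par \<in> space (prob_algebra (particle_space N D))"
  using assms
  by (subst mutate_initial[where par'="\<lambda>_. xt"]) (auto intro!: mutate_in_prob_algebra)

lemma forward_law_in_prob_algebra:
  assumes x: "x \<in> space (path_space T D)" and "1 \<le> t" "t \<le> T"
  shows "forward_law m G N D x t \<in> space (prob_algebra (forward_space N D t))"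
  using \<open>1 \<le> t\<close> \<open>t \<le> T\<close>
proof (induction t rule: dec_induct)
  case base
  have "x 1 \<in> space (vec_space D)" using x base by (auto simp: path_space_def space_PiM)
  then have "mutate m N D 1 (x 1) (\<lambda>_ _. 0) \<in> space (prob_algebra (particle_space N D))"
    by (rule mutate_initial_in_prob_algebra)
  \<comment> \<open>Viewing the law as a constant kernel turns measurability of the bind into
    membership in the space of probability measures.\<close>
  from measurable_bind_prob_space[OF measurable_const[OF this]
      measurable_compose[OF measurable_forward_start measurable_return_prob_space], of "count_space UNIV"]
  show ?case by (auto dest!: measurable_space)
next
  case (step t)
  then have "x (Suc t) \<in> space (vec_space D)" using x by (auto simp: path_space_def space_PiM)
  with step measurable_bind_prob_space[OF measurable_const measurable_forward_step(1)[of t "x (Suc t)" D N],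
      of "forward_law m G N D x t" "count_space UNIV"]
  show ?case by (auto simp del: forward_law.simps simp: forward_law_Suc dest!: measurable_space)
qed

section \<open>Measurability of the backward pass\<close>

lemma measurable_backward_index_law:
  assumes "1 \<le> t" "t < T"
  shows "(\<lambda>(w, K). backward_index_law bs m G N D (fst w) (snd w) t (K (Suc t)))
      \<in> forward_space N D T \<Otimes>\<^sub>M PiM {Suc t..T} (\<lambda>_. index_space N) \<rightarrow>\<^sub>M subprob_algebra (index_space N)"
proof -
  let ?X = "forward_space N D T \<Otimes>\<^sub>M PiM {Suc t..T} (\<lambda>_. index_space N)"
  have K: "(\<lambda>p. snd p (Suc t)) \<in> ?X \<rightarrow>\<^sub>M index_space N"
    using assms by (intro measurable_compose[OF measurable_snd measurable_component_singleton]) auto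
  have Z: "(\<lambda>p. fst (fst p) s) \<in> ?X \<rightarrow>\<^sub>M particle_space N D" if "s \<in> {1..T}" for s
    using that by (intro measurable_compose[OF measurable_fst measurable_forward_Z]) auto
  have A: "(\<lambda>p. snd (fst p) t) \<in> ?X \<rightarrow>\<^sub>M ancestor_space N"
    using assms by (intro measurable_compose[OF measurable_fst measurable_forward_A]) auto
  show ?thesis
  proof (cases bs)
    case True
    have "(\<lambda>p. fst (fst p) (Suc t)) \<in> ?X \<rightarrow>\<^sub>M PiM {0..N} (\<lambda>_. vec_space D)"
      using Z[of "Suc t"] assms by (simp add: particle_space_def)
    then have "(\<lambda>p. fst (fst p) (Suc t) (snd p (Suc t))) \<in> ?X \<rightarrow>\<^sub>M vec_space D"
      using K by (rule measurable_select)
    moreover have "(\<lambda>p. fst (fst p) t) \<in> ?X \<rightarrow>\<^sub>M particle_space N D"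
      using Z[of t] assms by simp
    ultimately show ?thesis
      using True measurable_backward_weight_law[of t "\<lambda>p. fst (fst p) t" ?X N D "\<lambda>p. fst (fst p) (Suc t) (snd p (Suc t))"]
        assms(1) by (simp add: backward_index_law_def case_prod_beta')
  next
    case False
    have "(\<lambda>p. snd (fst p) t (snd p (Suc t))) \<in> ?X \<rightarrow>\<^sub>M index_space N"
      using measurable_select[OF A[unfolded ancestor_space_def] K] .
    from measurable_compose[OF this return_measurable] show ?thesis
      using False by (simp add: backward_index_law_def case_prod_beta')
  qed
qed

text \<open>The partial index vector lives on \<open>{Suc t..T}\<close>, the times already sampled.
  Each step of the recursion enlarges this set by one time, until it is \<open>{1..T}\<close> at
  \<open>t = 0\<close>.\<close>

lemma measurable_backward_law:
  assumes "t < T"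
  shows "(\<lambda>(w, K). backward_law bs m G N D T (fst w) (snd w) t K)
      \<in> forward_space N D T \<Otimes>\<^sub>M PiM {Suc t..T} (\<lambda>_. index_space N)
         \<rightarrow>\<^sub>M subprob_algebra (PiM {1..T} (\<lambda>_. index_space N))"
  using assms
proof (induction t)
  case 0
  show ?case
    unfolding backward_law.simps case_prod_beta' One_nat_def
    by (intro measurable_compose[OF measurable_snd return_measurable])
next
  case (Suc t)
  let ?X = "forward_space N D T \<Otimes>\<^sub>M PiM {Suc (Suc t)..T} (\<lambda>_. index_space N)"
  have "{Suc t..T} = {Suc (Suc t)..T} \<union> {Suc t}" using Suc by auto
  then have "(\<lambda>p. (snd (fst p))(Suc t := snd p)) \<in> ?X \<Otimes>\<^sub>M index_space N \<rightarrow>\<^sub>M PiM {Suc t..T} (\<lambda>_. index_space N)"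
    by (rule measurable_fun_upd) measurable
  then have "(\<lambda>p. (fst (fst p), (snd (fst p))(Suc t := snd p)))
      \<in> ?X \<Otimes>\<^sub>M index_space N \<rightarrow>\<^sub>M forward_space N D T \<Otimes>\<^sub>M PiM {Suc t..T} (\<lambda>_. index_space N)"
    by measurable
  from measurable_compose[OF this Suc.IH]
  show ?case
    using Suc.prems measurable_backward_index_law[of "Suc t" T bs N D]
    unfolding backward_law.simps case_prod_beta'
    by (intro measurable_bind[where N="index_space N"]) auto
qed

subsection \<open>The event that all indices vanish\<close>

text \<open>The chance that all free ancestors drawn at time \<open>t\<close> are \<open>0\<close>;
  the exponent is \<open>N\<close> because ancestor \<open>0\<close> is set, not sampled.\<close>

definition "survive N D t z = ennreal ((Gvec G D t (z 0) / (\<Sum>l=0..N. Gvec G D t (z l))) ^ N)"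

lemma emeasure_resample_zero:
  assumes "t \<ge> 1"
  shows "emeasure (resample G N D t z) {\<lambda>n\<in>{0..N}. 0} = survive N D t z"
proof -
  let ?M = "\<lambda>n. if n = 0 then return (index_space N) 0 else weighted_index_law N (\<lambda>l. Gvec G D t (z l))"
  let ?w = "Gvec G D t (z 0) / (\<Sum>l=0..N. Gvec G D t (z l))"
  have "{\<lambda>n\<in>{0..N}. 0} = (\<Pi>\<^sub>E n\<in>{0..N}. {0 :: nat})"
    using PiE_singleton[of "\<lambda>n\<in>{0..N}. 0 :: nat" "{0..N}"] by (simp cong: PiE_cong)
  then have "emeasure (resample G N D t z) {\<lambda>n\<in>{0..N}. 0} = (\<Prod>n\<in>{0..N}. emeasure (?M n) {0})"
    unfolding resample_def using assms
    by (subst emeasure_PiM_prob[symmetric])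
      (auto intro!: prob_space_return prob_space_weighted_index_law Gvec_pos)
  also have "\<dots> = (\<Prod>n\<in>{0..N}. if n = 0 then 1 else ennreal ?w)"
    by (intro prod.cong) (auto simp: emeasure_weighted_index_law_0)
  also have "\<dots> = ennreal ?w ^ N"
    by (simp add: prod.atLeast_Suc_atMost)
  also have "\<dots> = ennreal (?w ^ N)"
    using assms by (intro ennreal_power divide_nonneg_nonneg sum_nonneg) (auto simp: Gvec_pos less_imp_le)
  finally show ?thesis by (simp add: survive_def)
qed

lemma measurable_survive:
  assumes "t \<ge> 1" shows "survive N D t \<in> borel_measurable (particle_space N D)"
proof -
  have "survive N D t = (\<lambda>z. emeasure (resample G N D t z) {\<lambda>n\<in>{0..N}. 0})"
    using emeasure_resample_zero[OF assms] by auto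
  then show ?thesis
    using measurable_compose[OF measurable_prob_algebraD[OF measurable_resample[OF assms]]
      measurable_emeasure_subprob_algebra[OF singleton_in_sets_ancestor_space]] by simp
qed

definition parent :: "(nat \<Rightarrow> nat \<Rightarrow> real) \<Rightarrow> nat \<Rightarrow> nat \<Rightarrow> real" where
  "parent x t = (if t = 1 then (\<lambda>_. 0) else x (t - 1))"

text \<open>The law of the particles at time \<open>t\<close> when every parent is the reference
  state. For \<open>t = 1\<close> it uses the same zero dummy as \<open>forward_law\<close> and so
  agrees literally with its initial step.\<close>

definition "step_law N D x t = mutate m N D t (x t) (\<lambda>_. parent x t)"

lemma path_in_vec_space: "x \<in> space (path_space T D) \<Longrightarrow> t \<in> {1..T} \<Longrightarrow> x t \<in> space (vec_space D)"
  by (auto simp: path_space_def space_PiM PiE_iff)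

lemma step_law_in_prob_algebra:
  assumes "x \<in> space (path_space T D)" "t \<in> {1..T}"
  shows "step_law N D x t \<in> space (prob_algebra (particle_space N D))"
proof (cases "t = 1")
  case True
  then show ?thesis
    using mutate_initial_in_prob_algebra[OF path_in_vec_space[OF assms]] by (simp add: step_law_def)
next
  case False
  then have "t - 1 \<in> {1..T}" using assms(2) by auto
  then show ?thesis
    using False assms path_in_vec_space[OF assms] path_in_vec_space[OF assms(1), of "t - 1"]
    by (auto simp: step_law_def parent_def intro!: mutate_in_prob_algebra)
qed

lemma measurable_zero_event:
  assumes "\<And>s. s \<in> {1..t} \<Longrightarrow> f s \<in> borel_measurable (particle_space N D)"
  shows "(\<lambda>w. (\<Prod>s=1..t. f s (fst w s)) * indicator {zero_ancestors N t} (snd w) :: ennreal)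
      \<in> borel_measurable (forward_space N D t)"
proof (rule borel_measurable_times_ennreal)
  show "(\<lambda>w. \<Prod>s=1..t. f s (fst w s)) \<in> borel_measurable (forward_space N D t)"
    using assms by (intro borel_measurable_prod_ennreal measurable_compose[OF measurable_forward_Z]) auto
  show "(\<lambda>w. indicator {zero_ancestors N t} (snd w) :: ennreal) \<in> borel_measurable (forward_space N D t)"
    unfolding forward_space_def
    by (intro measurable_compose[OF measurable_snd] borel_measurable_indicator singleton_zero_ancestors)
qed

text \<open>Keep only the branch on which all ancestors at time \<open>t\<close> are
  \<open>0\<close>. It has probability \<open>survive\<close>, and since particle \<open>0\<close>
  sits at \<open>x t\<close>, the new particles then follow \<open>step_law\<close> whatever the
  rest of \<open>w\<close>. The test functions \<open>f s\<close> carry along whatever is later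
  required of the particles at time \<open>s\<close>.\<close>

lemma forward_step_ge:
  fixes f :: "nat \<Rightarrow> (nat \<Rightarrow> nat \<Rightarrow> real) \<Rightarrow> ennreal"
  assumes x: "x \<in> space (path_space T D)" and t: "1 \<le> t" "Suc t \<le> T"
    and f: "\<And>s. s \<in> {1..Suc t} \<Longrightarrow> f s \<in> borel_measurable (particle_space N D)"
    and w: "w \<in> space (forward_space N D t)" "snd w = zero_ancestors N t" "fst w t 0 = x t"
  shows "(\<Prod>s=1..t. f s (fst w s)) * survive N D t (fst w t) * (\<integral>\<^sup>+z. f (Suc t) z \<partial>step_law N D x (Suc t))
    \<le> (\<integral>\<^sup>+v. (\<Prod>s=1..Suc t. f s (fst v s)) * indicator {zero_ancestors N (Suc t)} (snd v)
          \<partial>forward_step N D (x (Suc t)) t w)"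
proof -
  have xt: "x (Suc t) \<in> space (vec_space D)" using path_in_vec_space[OF x] t by simp
  let ?h = "\<lambda>v. (\<Prod>s=1..Suc t. f s (fst v s)) * indicator {zero_ancestors N (Suc t)} (snd v) :: ennreal"
  let ?a = "\<lambda>n\<in>{0..N}. 0 :: nat"
  let ?K = "\<lambda>a. mutate m N D (Suc t) (x (Suc t)) (\<lambda>n. fst w t (a n)) \<bind> (\<lambda>z.
     return (forward_space N D (Suc t)) ((fst w)(Suc t := z), (snd w)(t := a)))"
  have wt: "fst w t \<in> space (particle_space N D)"
    using measurable_space[OF measurable_forward_Z w(1)] t by auto
  have R: "sets (resample G N D t (fst w t)) = sets (ancestor_space N)"
    using measurable_space[OF measurable_resample wt] t by (auto simp: space_prob_algebra)
  have mut: "mutate m N D (Suc t) (x (Suc t)) (\<lambda>n. fst w t (?a n)) = step_law N D x (Suc t)"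
    unfolding step_law_def mutate_def parent_def using w(3) t by (intro PiM_cong) auto
  have h: "?h \<in> borel_measurable (forward_space N D (Suc t))"
    by (rule measurable_zero_event) (rule f)
  have K: "?K \<in> ancestor_space N \<rightarrow>\<^sub>M subprob_algebra (forward_space N D (Suc t))"
    using measurable_compose[OF measurable_Pair1'[OF w(1)] measurable_forward_step(2)[OF t(1) xt]]
    by (intro measurable_prob_algebraD) simp
  have a: "?a \<in> space (ancestor_space N)"
    using sets.sets_into_space[OF singleton_in_sets_ancestor_space] by auto
  have step: "sets (step_law N D x (Suc t)) = sets (particle_space N D)"
    using step_law_in_prob_algebra[OF x, of "Suc t"] t by (auto simp: space_prob_algebra)
  have app: "(\<lambda>z. ((fst w)(Suc t := z), (snd w)(t := ?a)))
      \<in> particle_space N D \<rightarrow>\<^sub>M forward_space N D (Suc t)"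
    using measurable_compose[OF measurable_Pair1'[of "(w, ?a)" "forward_space N D t \<Otimes>\<^sub>M ancestor_space N"
          "particle_space N D"] measurable_forward_append[OF t(1)]]
      w(1) a by (auto simp: space_pair_measure)
  have "(\<integral>\<^sup>+v. ?h v \<partial>?K ?a) = (\<integral>\<^sup>+z. \<integral>\<^sup>+v. ?h v \<partial>return (forward_space N D (Suc t))
            ((fst w)(Suc t := z), (snd w)(t := ?a)) \<partial>step_law N D x (Suc t))"
    unfolding mut
    by (intro nn_integral_bind[OF h] measurable_compose[OF _ return_measurable])
      (use app step in \<open>simp cong: measurable_cong_sets\<close>)
  also have "\<dots> = (\<integral>\<^sup>+z. (\<Prod>s=1..t. f s (fst w s)) * f (Suc t) z \<partial>step_law N D x (Suc t))"
  proof (rule nn_integral_cong)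
    fix z assume "z \<in> space (step_law N D x (Suc t))"
    then have z: "z \<in> space (particle_space N D)" using sets_eq_imp_space_eq[OF step] by simp
    have "(\<integral>\<^sup>+v. ?h v \<partial>return (forward_space N D (Suc t)) ((fst w)(Suc t := z), (snd w)(t := ?a))) =
        ?h ((fst w)(Suc t := z), (snd w)(t := ?a))"
      by (rule nn_integral_return[OF measurable_space[OF app z] h])
    also have "\<dots> = ?h ((fst w)(Suc t := z), zero_ancestors N (Suc t))"
      by (simp only: w(2) zero_ancestors_upd[OF t(1)])
    also have "?h ((fst w)(Suc t := z), zero_ancestors N (Suc t)) = (\<Prod>s=1..t. f s (fst w s)) * f (Suc t) z"
      by (auto intro!: arg_cong2[where f="(*)"] prod.cong)
    finally show "(\<integral>\<^sup>+v. ?h v \<partial>return (forward_space N D (Suc t)) ((fst w)(Suc t := z), (snd w)(t := ?a))) =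
      (\<Prod>s=1..t. f s (fst w s)) * f (Suc t) z" .
  qed
  also have "\<dots> = (\<Prod>s=1..t. f s (fst w s)) * (\<integral>\<^sup>+z. f (Suc t) z \<partial>step_law N D x (Suc t))"
    using f[of "Suc t"] step by (intro nn_integral_cmult) (simp cong: measurable_cong_sets)
  finally have "(\<Prod>s=1..t. f s (fst w s)) * survive N D t (fst w t) * (\<integral>\<^sup>+z. f (Suc t) z \<partial>step_law N D x (Suc t))
      = emeasure (resample G N D t (fst w t)) {?a} * (\<integral>\<^sup>+v. ?h v \<partial>?K ?a)"
    using t by (simp add: emeasure_resample_zero mult_ac)
  also have "\<dots> \<le> (\<integral>\<^sup>+v. ?h v \<partial>(resample G N D t (fst w t) \<bind> ?K))"
    using K singleton_in_sets_ancestor_space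
    by (intro nn_integral_bind_ge[OF _ _ h]) (simp_all only: measurable_cong_sets[OF R refl] R)
  finally show ?thesis by (simp add: forward_step_def)
qed

text \<open>Once all ancestor indices vanish, the particles at time \<open>t\<close> are sampled from the reference
  state at time \<open>t - 1\<close>, so that the time steps decouple.\<close>

lemma forward_law_ge:
  fixes f :: "nat \<Rightarrow> (nat \<Rightarrow> nat \<Rightarrow> real) \<Rightarrow> ennreal"
  assumes x: "x \<in> space (path_space T D)" and "1 \<le> t" "t \<le> T"
    and f: "\<And>s. s \<in> {1..t} \<Longrightarrow> f s \<in> borel_measurable (particle_space N D)"
    and f0: "\<And>s z. s \<in> {1..t} \<Longrightarrow> z 0 \<noteq> x s \<Longrightarrow> f s z = 0"
  shows "(\<Prod>s\<in>{1..<t}. \<integral>\<^sup>+z. f s z * survive N D s z \<partial>step_law N D x s) * (\<integral>\<^sup>+z. f t z \<partial>step_law N D x t)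
    \<le> (\<integral>\<^sup>+w. (\<Prod>s=1..t. f s (fst w s)) * indicator {zero_ancestors N t} (snd w) \<partial>forward_law m G N D x t)"
  using \<open>1 \<le> t\<close> \<open>t \<le> T\<close> f f0
proof (induction t arbitrary: f rule: dec_induct)
  case base
  let ?h = "\<lambda>w. (\<Prod>s=1..1. f s (fst w s)) * indicator {zero_ancestors N 1} (snd w) :: ennreal"
  let ?R = "\<lambda>z. return (forward_space N D 1) ((\<lambda>_. undefined)(1 := z), \<lambda>_. undefined)"
  have F: "forward_law m G N D x 1 = step_law N D x 1 \<bind> ?R"
    by (simp add: step_law_def parent_def)
  have sets: "sets (step_law N D x 1) = sets (particle_space N D)"
    using step_law_in_prob_algebra[OF x, of 1] base.prems(1) by (auto simp: space_prob_algebra)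
  have h: "?h \<in> borel_measurable (forward_space N D 1)"
    by (rule measurable_zero_event) (rule base.prems(2))
  have R: "?R \<in> step_law N D x 1 \<rightarrow>\<^sub>M subprob_algebra (forward_space N D 1)"
    unfolding measurable_cong_sets[OF sets refl]
    by (rule measurable_compose[OF measurable_forward_start return_measurable])
  have "(\<integral>\<^sup>+w. ?h w \<partial>(step_law N D x 1 \<bind> ?R)) = (\<integral>\<^sup>+z. \<integral>\<^sup>+w. ?h w \<partial>?R z \<partial>step_law N D x 1)"
    by (rule nn_integral_bind[OF h R])
  also have "\<dots> = (\<integral>\<^sup>+z. f 1 z \<partial>step_law N D x 1)"
  proof (rule nn_integral_cong)
    fix z assume "z \<in> space (step_law N D x 1)"
    then have z: "z \<in> space (particle_space N D)" using sets_eq_imp_space_eq[OF sets] by simp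
    show "(\<integral>\<^sup>+w. ?h w \<partial>?R z) = f 1 z"
      by (subst nn_integral_return[OF measurable_space[OF measurable_forward_start z] h])
        (simp add: zero_ancestors_def restrict_def)
  qed
  finally show ?case unfolding F by simp
next
  case (step t)
  let ?h = "\<lambda>w. (\<Prod>s=1..Suc t. f s (fst w s)) * indicator {zero_ancestors N (Suc t)} (snd w) :: ennreal"
  \<comment> \<open>Survival at time \<open>t\<close> is a function of the particles at time
    \<open>t\<close>, so it is absorbed into the test function there; this is why the induction runs
    over arbitrary \<open>f\<close>.\<close>
  let ?f' = "f(t := \<lambda>z. f t z * survive N D t z)"
  let ?I = "\<integral>\<^sup>+z. f (Suc t) z \<partial>step_law N D x (Suc t)"
  let ?F = "forward_law m G N D x t"
  have F: "sets ?F = sets (forward_space N D t)"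
    using forward_law_in_prob_algebra[OF x, of t N] step by (auto simp: space_prob_algebra)
  have f'_meas: "?f' s \<in> borel_measurable (particle_space N D)" if "s \<in> {1..t}" for s
    using that step.prems(2)[of s] step.hyps measurable_survive[of t N D] by auto
  have "(\<Prod>s\<in>{1..<Suc t}. \<integral>\<^sup>+z. f s z * survive N D s z \<partial>step_law N D x s) =
      (\<Prod>s\<in>{1..<t}. \<integral>\<^sup>+z. ?f' s z * survive N D s z \<partial>step_law N D x s) * (\<integral>\<^sup>+z. ?f' t z \<partial>step_law N D x t)"
    using step.hyps by (subst prod.atLeastLessThan_Suc) (auto intro!: arg_cong2[where f="(*)"] prod.cong)
  also have "\<dots> \<le> (\<integral>\<^sup>+w. (\<Prod>s=1..t. ?f' s (fst w s)) * indicator {zero_ancestors N t} (snd w) \<partial>?F)"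
  proof (rule step.IH)
    show "?f' s z = 0" if "s \<in> {1..t}" "z 0 \<noteq> x s" for s z
      using step.prems(3)[of s z] that by auto
  qed (use step.prems(1) f'_meas in auto)
  finally have "(\<Prod>s\<in>{1..<Suc t}. \<integral>\<^sup>+z. f s z * survive N D s z \<partial>step_law N D x s) * ?I
     \<le> (\<integral>\<^sup>+w. (\<Prod>s=1..t. ?f' s (fst w s)) * indicator {zero_ancestors N t} (snd w) \<partial>?F) * ?I"
    by (rule mult_right_mono) simp
  also have "\<dots> = (\<integral>\<^sup>+w. (\<Prod>s=1..t. ?f' s (fst w s)) * indicator {zero_ancestors N t} (snd w) * ?I \<partial>?F)"
    using measurable_zero_event[of t ?f', OF f'_meas] F
    by (intro nn_integral_multc[symmetric]) (simp cong: measurable_cong_sets)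
  also have "\<dots> \<le> (\<integral>\<^sup>+w. (\<integral>\<^sup>+v. ?h v \<partial>forward_step N D (x (Suc t)) t w) \<partial>?F)"
  proof (rule nn_integral_mono)
    fix w assume "w \<in> space ?F"
    then have w: "w \<in> space (forward_space N D t)" using sets_eq_imp_space_eq[OF F] by simp
    have split: "{1..t} = insert t {1..<t}" using step.hyps by auto
    have prod: "(\<Prod>s=1..t. ?f' s (fst w s)) = (\<Prod>s=1..t. f s (fst w s)) * survive N D t (fst w t)"
    proof -
      have "(\<Prod>s\<in>{1..<t}. ?f' s (fst w s)) = (\<Prod>s\<in>{1..<t}. f s (fst w s))"
        by (intro prod.cong) auto
      then show ?thesis unfolding split by (simp add: mult_ac)
    qed
    show "(\<Prod>s=1..t. ?f' s (fst w s)) * indicator {zero_ancestors N t} (snd w) * ?I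
        \<le> (\<integral>\<^sup>+v. ?h v \<partial>forward_step N D (x (Suc t)) t w)"
    proof (cases "snd w = zero_ancestors N t \<and> fst w t 0 = x t")
      case True
      then show ?thesis
        unfolding prod
        using forward_step_ge[OF x step.hyps(1) step.prems(1,2) w] by simp
    next
      case False
      \<comment> \<open>Off the reference state \<open>f t\<close> vanishes by assumption, so the
        left side is \<open>0\<close> and nothing remains to be shown.\<close>
      then have "snd w \<noteq> zero_ancestors N t \<or> f t (fst w t) = 0"
        using step.prems(3)[of t] step.hyps by auto
      then have "(\<Prod>s=1..t. ?f' s (fst w s)) * indicator {zero_ancestors N t} (snd w) = 0"
        unfolding prod split by auto
      then show ?thesis by (simp only: mult_zero_left zero_le)
    qed
  qed
  also have "\<dots> = (\<integral>\<^sup>+v. ?h v \<partial>forward_law m G N D x (Suc t))"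
    unfolding forward_law_Suc[OF step.hyps(1)]
    using measurable_prob_algebraD[OF measurable_forward_step(1)[OF step.hyps(1), of "x (Suc t)" D N]]
      path_in_vec_space[OF x] step.prems F
    by (intro nn_integral_bind[symmetric, where B="forward_space N D (Suc t)"] measurable_zero_event)
      (auto cong: measurable_cong_sets)
  finally show ?case .
qed

section \<open>The backward pass along the all-zero branch\<close>

lemma measurable_backward_kernel_index:
  assumes w: "w \<in> space (forward_space N D T)" and t: "t < T"
    and K: "\<And>k. k \<in> {0..N} \<Longrightarrow> K k \<in> space (PiM {Suc t..T} (\<lambda>_. index_space N))"
  shows "(\<lambda>k. backward_law bs m G N D T (fst w) (snd w) t (K k))
      \<in> index_space N \<rightarrow>\<^sub>M subprob_algebra (PiM {1..T} (\<lambda>_. index_space N))"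
proof -
  have "(\<lambda>k. (w, K k)) \<in> index_space N \<rightarrow>\<^sub>M forward_space N D T \<Otimes>\<^sub>M PiM {Suc t..T} (\<lambda>_. index_space N)"
    using w K by (auto simp: space_pair_measure)
  from measurable_compose[OF this measurable_backward_law[OF t]] show ?thesis by simp
qed

text \<open>With the indices on \<open>{Suc t..T}\<close> already \<open>0\<close>, each remaining
  draw is cut down to its atom at \<open>0\<close>, and the product collects these atoms.\<close>

lemma emeasure_backward_law_zero_ge:
  assumes w: "w \<in> space (forward_space N D T)" and "t < T"
  shows "(\<Prod>s=1..t. emeasure (backward_index_law bs m G N D (fst w) (snd w) s 0) {0})
    \<le> emeasure (backward_law bs m G N D T (fst w) (snd w) t (\<lambda>s\<in>{Suc t..T}. 0)) {\<lambda>s\<in>{1..T}. 0}"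
  using \<open>t < T\<close>
proof (induction t)
  case 0
  show ?case
    unfolding backward_law.simps One_nat_def
      emeasure_return_singleton[OF singleton_zero_indices[of T N, unfolded One_nat_def]] by simp
next
  case (Suc t)
  let ?K = "\<lambda>s\<in>{Suc (Suc t)..T}. 0 :: nat"
  let ?z = "{\<lambda>s\<in>{1..T}. 0 :: nat}"
  let ?B = "backward_index_law bs m G N D (fst w) (snd w) (Suc t) 0"
  let ?L = "\<lambda>k. backward_law bs m G N D T (fst w) (snd w) t (?K(Suc t := k))"
  have K: "?K(Suc t := 0) = (\<lambda>s\<in>{Suc t..T}. 0)" using Suc.prems by (auto simp: fun_eq_iff)
  have B: "sets ?B = sets (index_space N)" by (simp add: backward_index_law_def)
  have L: "?L \<in> ?B \<rightarrow>\<^sub>M subprob_algebra (PiM {1..T} (\<lambda>_. index_space N))"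
    unfolding measurable_cong_sets[OF B refl] using Suc.prems
    by (intro measurable_backward_kernel_index[OF w]) (auto simp: space_PiM PiE_iff extensional_def)
  have "(\<Prod>s=1..Suc t. emeasure (backward_index_law bs m G N D (fst w) (snd w) s 0) {0})
      = emeasure ?B {0} * (\<Prod>s=1..t. emeasure (backward_index_law bs m G N D (fst w) (snd w) s 0) {0})"
    by (simp add: mult.commute)
  also have "\<dots> \<le> emeasure ?B {0} * emeasure (?L 0) ?z"
    unfolding K using Suc.prems by (intro mult_left_mono Suc.IH) auto
  also have "\<dots> \<le> emeasure (?B \<bind> ?L) ?z"
    using sets_eq_imp_space_eq[OF B] by (intro emeasure_bind_ge[OF L] singleton_zero_indices) (auto simp: B)
  also have "?B \<bind> ?L = backward_law bs m G N D T (fst w) (snd w) (Suc t) ?K"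
    using Suc.prems by simp
  finally show ?case .
qed

text \<open>Everything after the forward pass, as one kernel in its final state, so that the law of
  all indices is a single bind.\<close>

definition selection_law where
  "selection_law bs fm N D T w =
     final_index_law fm G N D T (fst w T) \<bind> (\<lambda>k.
     backward_law bs m G N D T (fst w) (snd w) (T - 1) ((\<lambda>_. undefined)(T := k)) \<bind> (\<lambda>K.
     return (indices_space N T) (snd w, K)))"

lemma icsmc_indices_law_alt:
  "icsmc_indices_law bs fm m G N T D x = forward_law m G N D x T \<bind> selection_law bs fm N D T"
  by (simp add: icsmc_indices_law_def selection_law_def[abs_def] case_prod_beta')

lemma measurable_selection_tail:
  assumes "T \<ge> 1"
  shows "(\<lambda>(w, k). backward_law bs m G N D T (fst w) (snd w) (T - 1) ((\<lambda>_. undefined)(T := k)) \<bind> (\<lambda>K.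
     return (indices_space N T) (snd w, K)))
      \<in> forward_space N D T \<Otimes>\<^sub>M index_space N \<rightarrow>\<^sub>M subprob_algebra (indices_space N T)"
  unfolding case_prod_beta'
proof (rule measurable_bind[where N="PiM {1..T} (\<lambda>_. index_space N)"])
  let ?X = "forward_space N D T \<Otimes>\<^sub>M index_space N"
  \<comment> \<open>As \<open>T \<ge> 1\<close>, the set \<open>{Suc (T - 1)..T}\<close> is
    \<open>{T}\<close>: only the final index is known at this stage.\<close>
  have "(\<lambda>p. (\<lambda>_. undefined)(T := snd p)) \<in> ?X \<rightarrow>\<^sub>M PiM {Suc (T - 1)..T} (\<lambda>_. index_space N)"
    using assms by (intro measurable_fun_upd[where J="{}"] measurable_const) (auto simp: space_PiM)
  then have "(\<lambda>p. (fst p, (\<lambda>_. undefined)(T := snd p))) \<in> ?X \<rightarrow>\<^sub>M forward_space N D T \<Otimes>\<^sub>M PiM {Suc (T - 1)..T} (\<lambda>_. index_space N)"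
    by (intro measurable_Pair measurable_fst)
  from measurable_compose[OF this measurable_backward_law[of "T - 1" T bs N D]] assms
  show "(\<lambda>p. backward_law bs m G N D T (fst (fst p)) (snd (fst p)) (T - 1) ((\<lambda>_. undefined)(T := snd p)))
      \<in> ?X \<rightarrow>\<^sub>M subprob_algebra (PiM {1..T} (\<lambda>_. index_space N))"
    by simp
  have "(\<lambda>q. (snd (fst (fst q)), snd q)) \<in> ?X \<Otimes>\<^sub>M PiM {1..T} (\<lambda>_. index_space N) \<rightarrow>\<^sub>M indices_space N T"
    unfolding forward_space_def indices_space_def by measurable
  from measurable_compose[OF this return_measurable]
  show "(\<lambda>q. return (indices_space N T) (snd (fst (fst q)), snd q))
      \<in> ?X \<Otimes>\<^sub>M PiM {1..T} (\<lambda>_. index_space N) \<rightarrow>\<^sub>M subprob_algebra (indices_space N T)" .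
qed

lemma measurable_selection_law:
  assumes "T \<ge> 1"
  shows "selection_law bs fm N D T \<in> forward_space N D T \<rightarrow>\<^sub>M subprob_algebra (indices_space N T)"
  unfolding selection_law_def[abs_def]
proof (rule measurable_bind'[OF measurable_compose[OF measurable_forward_Z measurable_final_index_law]])
  show "(\<lambda>(w, k). backward_law bs m G N D T (fst w) (snd w) (T - 1) ((\<lambda>_. undefined)(T := k)) \<bind> (\<lambda>K.
     return (indices_space N T) (snd w, K)))
      \<in> forward_space N D T \<Otimes>\<^sub>M index_space N \<rightarrow>\<^sub>M subprob_algebra (indices_space N T)"
    by (rule measurable_selection_tail[OF assms])
qed (use assms in auto)

text \<open>The probability of \<open>K\<^sub>s = 0\<close> given \<open>K\<^sub>s\<^sub>+\<^sub>1 = 0\<close>, when \<open>z\<close> is the particle cloud at time \<open>s\<close> and the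
  particles with index \<open>0\<close> follow \<open>x\<close>.\<close>

definition keep :: "bool \<Rightarrow> bool \<Rightarrow> nat \<Rightarrow> nat \<Rightarrow> nat \<Rightarrow> (nat \<Rightarrow> nat \<Rightarrow> real) \<Rightarrow> nat \<Rightarrow> (nat \<Rightarrow> nat \<Rightarrow> real) \<Rightarrow> ennreal" where
  "keep bs fm N D T x s z =
     (if s = T then emeasure (final_index_law fm G N D T z) {0}
      else if bs then emeasure (weighted_index_law N (\<lambda>k. Gvec G D s (z k) * mvec m D (s + 1) (z k) (x (s + 1)))) {0}
      else 1)"

lemma measurable_keep:
  assumes "x \<in> space (path_space T D)" "s \<in> {1..T}"
  shows "keep bs fm N D T x s \<in> borel_measurable (particle_space N D)"
proof (cases "s = T")
  case True
  then show ?thesis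
    using assms measurable_compose[OF measurable_final_index_law[of T fm N D] measurable_emeasure_subprob_algebra[of "{0}"]]
    by (auto simp: keep_def[abs_def])
next
  case False
  then have "x (s + 1) \<in> space (vec_space D)" using assms by (intro path_in_vec_space) auto
  then have "(\<lambda>z. weighted_index_law N (\<lambda>k. Gvec G D s (z k) * mvec m D (s + 1) (z k) (x (s + 1))))
      \<in> particle_space N D \<rightarrow>\<^sub>M subprob_algebra (index_space N)"
    using assms by (intro measurable_backward_weight_law[where f="\<lambda>z. z"] measurable_const) auto
  from measurable_compose[OF this measurable_emeasure_subprob_algebra[of "{0}"]] False
  show ?thesis by (cases bs) (auto simp: keep_def[abs_def])
qed

text \<open>The two backward rules meet here. With backward sampling the weights at time
  \<open>s\<close> use particle \<open>0\<close> at time \<open>s + 1\<close>, which is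
  \<open>x (s + 1)\<close>; without it the traced ancestor is \<open>0\<close> and the factor is
  \<open>1\<close>. Either way the factor depends on the particles at time \<open>s\<close>
  alone.\<close>

lemma emeasure_selection_law_ge:
  assumes T: "T \<ge> 1" and w: "w \<in> space (forward_space N D T)"
    and A: "snd w = zero_ancestors N T" and Z: "\<And>s. s \<in> {1..T} \<Longrightarrow> fst w s 0 = x s"
  shows "(\<Prod>s=1..T. keep bs fm N D T x s (fst w s))
    \<le> emeasure (selection_law bs fm N D T w) {(zero_ancestors N T, \<lambda>s\<in>{1..T}. 0)}"
proof -
  let ?F = "final_index_law fm G N D T (fst w T)"
  let ?B = "\<lambda>k. backward_law bs m G N D T (fst w) (snd w) (T - 1) ((\<lambda>_. undefined)(T := k))"
  let ?R = "\<lambda>K. return (indices_space N T) (snd w, K)"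
  let ?S = "PiM {1..T} (\<lambda>_. index_space N)"
  let ?k = "\<lambda>s\<in>{1..T}. 0 :: nat"
  let ?z = "{(zero_ancestors N T, ?k)}"
  have K0: "(\<lambda>_. undefined)(T := 0 :: nat) = (\<lambda>s\<in>{Suc (T - 1)..T}. 0)"
    using T by (auto simp: fun_eq_iff)
  have bil: "keep bs fm N D T x s (fst w s) = emeasure (backward_index_law bs m G N D (fst w) (snd w) s 0) {0}"
    if "s \<in> {1..T - 1}" for s
  proof -
    have "fst w (s + 1) 0 = x (s + 1)" "s \<noteq> T" using Z[of "s + 1"] that T by auto
    then show ?thesis
      using that A by (auto simp: keep_def backward_index_law_def zero_ancestors_def emeasure_return)
  qed
  have split: "{1..T} = insert T {1..T - 1}" using T by auto
  have "(\<Prod>s=1..T. keep bs fm N D T x s (fst w s)) =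
      emeasure ?F {0} * (\<Prod>s=1..T - 1. emeasure (backward_index_law bs m G N D (fst w) (snd w) s 0) {0})"
    unfolding split using T bil by (subst prod.insert) (auto simp: keep_def[of bs fm N D T x T] intro!: arg_cong2[where f="(*)"] prod.cong)
  also have "\<dots> \<le> emeasure ?F {0} * emeasure (?B 0) {?k}"
    unfolding K0 using T by (intro mult_left_mono emeasure_backward_law_zero_ge w) auto
  also have "\<dots> \<le> emeasure ?F {0} * emeasure (?B 0 \<bind> ?R) ?z"
  proof (rule mult_left_mono)
    have sB: "?B 0 \<in> space (subprob_algebra ?S)"
      using measurable_space[OF measurable_backward_law[of "T - 1" T bs N D], of "(w, (\<lambda>_. undefined)(T := 0))"] w T
      by (auto simp: space_pair_measure space_PiM PiE_iff extensional_def)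
    have sets_B: "sets (?B 0) = sets ?S" using sB by (simp add: space_subprob_algebra)
    have swA: "snd w \<in> space (PiM {1..<T} (\<lambda>_. ancestor_space N))"
      using w by (auto simp: forward_space_def space_pair_measure)
    have R: "?R \<in> ?B 0 \<rightarrow>\<^sub>M subprob_algebra (indices_space N T)"
      unfolding measurable_cong_sets[OF sets_B refl] indices_space_def
      by (intro measurable_compose[OF measurable_Pair1'[OF swA] return_measurable])
    have k: "?k \<in> space ?S" by (auto simp: space_PiM)
    have "emeasure (?R ?k) ?z = 1"
      unfolding A by (rule emeasure_return_singleton[OF sets_zero_indices])
    then show "emeasure (?B 0) {?k} \<le> emeasure (?B 0 \<bind> ?R) ?z"
      using emeasure_bind_ge[OF R _ _ sets_zero_indices, of ?k] k sets_eq_imp_space_eq[OF sets_B]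
        singleton_zero_indices[of T N] sets_B by simp
  qed simp
  also have "\<dots> \<le> emeasure (?F \<bind> (\<lambda>k. ?B k \<bind> ?R)) ?z"
  proof -
    have s: "sets ?F = sets (index_space N)" by (simp add: final_index_law_def)
    have "(\<lambda>k. ?B k \<bind> ?R) \<in> ?F \<rightarrow>\<^sub>M subprob_algebra (indices_space N T)"
      unfolding measurable_cong_sets[OF s refl]
      using measurable_compose[OF measurable_Pair1'[OF w] measurable_selection_tail[OF T]] by simp
    then show ?thesis
      using sets_eq_imp_space_eq[OF s] s by (intro emeasure_bind_ge[OF _ _ _ sets_zero_indices]) auto
  qed
  finally show ?thesis by (simp add: selection_law_def)
qed

lemma icsmc_indices_law_zero_ge:
  assumes T: "T \<ge> 1" and x: "x \<in> space (path_space T D)"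
  shows "(\<Prod>s\<in>{1..<T}. \<integral>\<^sup>+z. keep bs fm N D T x s z * indicator {x s} (z 0) * survive N D s z \<partial>step_law N D x s)
      * (\<integral>\<^sup>+z. keep bs fm N D T x T z * indicator {x T} (z 0) \<partial>step_law N D x T)
    \<le> emeasure (icsmc_indices_law bs fm m G N T D x) {(zero_ancestors N T, \<lambda>s\<in>{1..T}. 0)}"
proof -
  \<comment> \<open>The indicator supplies the vanishing off the reference state that
    \<open>forward_law_ge\<close> asks for, and it loses nothing, because particle \<open>0\<close>
    equals \<open>x s\<close> almost surely under \<open>step_law\<close>.\<close>
  let ?f = "\<lambda>s z. keep bs fm N D T x s z * indicator {x s} (z 0)"
  let ?z = "{(zero_ancestors N T, \<lambda>s\<in>{1..T}. 0)}"
  have F: "forward_law m G N D x T \<in> space (prob_algebra (forward_space N D T))"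
    using forward_law_in_prob_algebra[OF x T] by simp
  then have sF: "sets (forward_law m G N D x T) = sets (forward_space N D T)"
    by (simp add: space_prob_algebra)
  have "?f s \<in> borel_measurable (particle_space N D)" if s: "s \<in> {1..T}" for s
  proof (intro borel_measurable_times_ennreal measurable_keep[OF x s])
    have "(\<lambda>z. z 0) \<in> particle_space N D \<rightarrow>\<^sub>M vec_space D" unfolding particle_space_def by measurable
    then show "(\<lambda>z. indicator {x s} (z 0) :: ennreal) \<in> borel_measurable (particle_space N D)"
      by (rule measurable_compose)
        (intro borel_measurable_indicator singleton_in_sets_vec_space path_in_vec_space[OF x s])
  qed
  then have "(\<Prod>s\<in>{1..<T}. \<integral>\<^sup>+z. ?f s z * survive N D s z \<partial>step_law N D x s) * (\<integral>\<^sup>+z. ?f T z \<partial>step_law N D x T)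
    \<le> (\<integral>\<^sup>+w. (\<Prod>s=1..T. ?f s (fst w s)) * indicator {zero_ancestors N T} (snd w) \<partial>forward_law m G N D x T)"
    using T by (intro forward_law_ge[OF x]) auto
  also have "\<dots> \<le> (\<integral>\<^sup>+w. emeasure (selection_law bs fm N D T w) ?z \<partial>forward_law m G N D x T)"
  proof (rule nn_integral_mono)
    fix w assume "w \<in> space (forward_law m G N D x T)"
    then have w: "w \<in> space (forward_space N D T)" using sets_eq_imp_space_eq[OF sF] by simp
    show "(\<Prod>s=1..T. ?f s (fst w s)) * indicator {zero_ancestors N T} (snd w) \<le> emeasure (selection_law bs fm N D T w) ?z"
    proof (cases "snd w = zero_ancestors N T \<and> (\<forall>s\<in>{1..T}. fst w s 0 = x s)")
      case True
      then have "(\<Prod>s=1..T. ?f s (fst w s)) = (\<Prod>s=1..T. keep bs fm N D T x s (fst w s))"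
        by (intro prod.cong) auto
      then show ?thesis
        using True emeasure_selection_law_ge[OF T w, of x bs fm] by simp
    next
      case False
      have "(\<Prod>s=1..T. ?f s (fst w s)) = 0" if "s \<in> {1..T}" "fst w s 0 \<noteq> x s" for s
        using that by (intro prod_zero) (auto intro!: bexI[of _ s])
      then have "(\<Prod>s=1..T. ?f s (fst w s)) * indicator {zero_ancestors N T} (snd w) = 0"
        using False by (cases "snd w = zero_ancestors N T") auto
      then show ?thesis by (simp only: zero_le)
    qed
  qed
  also have "\<dots> = emeasure (icsmc_indices_law bs fm m G N T D x) ?z"
    unfolding icsmc_indices_law_alt
    using F measurable_selection_law[OF T, of bs fm N D] prob_space.not_empty
    by (intro emeasure_bind[symmetric, OF _ _ sets_zero_indices])
      (auto simp: space_prob_algebra cong: measurable_cong_sets)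
  finally show ?thesis .
qed

lemma icsmc_indices_law_subprob:
  assumes T: "T \<ge> 1" and x: "x \<in> space (path_space T D)"
  shows "icsmc_indices_law bs fm m G N T D x \<in> space (subprob_algebra (indices_space N T))"
proof -
  have F: "forward_law m G N D x T \<in> space (prob_algebra (forward_space N D T))"
    using forward_law_in_prob_algebra[OF x T] by simp
  then interpret prob_space "forward_law m G N D x T" by (simp add: space_prob_algebra)
  have "sets (forward_law m G N D x T) = sets (forward_space N D T)"
    using F by (simp add: space_prob_algebra)
  then show ?thesis
    unfolding icsmc_indices_law_alt using measurable_selection_law[OF T, of bs fm N D]
    by (intro bind_in_space) (simp cong: measurable_cong_sets)
qed

lemma icsmc_dist_le:
  assumes T: "T \<ge> 1" and x: "x \<in> space (path_space T D)"
    and p: "ennreal p \<le> emeasure (icsmc_indices_law bs fm m G N T D x) {(zero_ancestors N T, \<lambda>s\<in>{1..T}. 0)}"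
  shows "icsmc_dist bs fm m G N T D x \<in> {0..1 - p}"
proof -
  let ?L = "icsmc_indices_law bs fm m G N T D x"
  let ?z = "(zero_ancestors N T, \<lambda>s\<in>{1..T}. 0)"
  have L: "subprob_space ?L" "sets ?L = sets (indices_space N T)"
    using icsmc_indices_law_subprob[OF T x] by (auto simp: space_subprob_algebra)
  interpret subprob_space ?L by fact
  have "?z \<in> space (indices_space N T)"
    using sets.sets_into_space[OF sets_zero_indices] by auto
  then have "tv_dist ?L (return (indices_space N T) ?z) \<in> {0..1 - measure ?L {?z}}"
    using L by (intro tv_dist_return sets_zero_indices)
  moreover have "p \<le> measure ?L {?z}"
    using p by (simp add: emeasure_eq_measure ennreal_le_iff)
  ultimately show ?thesis
    by (simp add: icsmc_dist_def zero_indices_law_def zero_ancestors_def)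
qed

subsection \<open>Relative weights\<close>

lemma prob_space_Mvec: "t \<ge> 1 \<Longrightarrow> prob_space (Mvec m D t u)"
  unfolding Mvec_def by (intro prob_space_PiM prob_space_Mker)

lemma sets_Mvec [simp, measurable_cong]: "sets (Mvec m D t u) = sets (vec_space D)"
  unfolding Mvec_def vec_space_def by (intro sets_PiM_cong) auto

text \<open>Coordinates are independent under \<open>Mvec\<close>, so the expected ratio is the
  product over \<open>d\<close> of \<open>Mop m t (h d) (u d) / k d\<close>. Taking
  \<open>h d = G t\<close> yields the resampling weights; multiplying by the density of the move to
  \<open>x (t + 1) d\<close> yields the backward-sampling weights.\<close>

lemma nn_integral_Mvec_ratio_le:
  assumes t: "t \<ge> 1"
    and h: "\<And>d. d \<in> {1..D} \<Longrightarrow> integrable (Mker m t (u d)) (h d)" "\<And>d y. d \<in> {1..D} \<Longrightarrow> 0 \<le> h d y"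
    and k: "\<And>d. d \<in> {1..D} \<Longrightarrow> 0 < k d"
  shows "(\<integral>\<^sup>+y. ennreal ((\<Prod>d=1..D. h d (y d)) / (\<Prod>d=1..D. k d)) \<partial>Mvec m D t u)
    \<le> ennreal (exp (- (\<Sum>d=1..D. ln (k d) - ln (Mop m t (h d) (u d)))))"
proof -
  have "(\<integral>\<^sup>+y. ennreal ((\<Prod>d=1..D. h d (y d)) / (\<Prod>d=1..D. k d)) \<partial>Mvec m D t u) =
      (\<integral>\<^sup>+y. (\<Prod>d\<in>{1..D}. ennreal (h d (y d) / k d)) \<partial>Mvec m D t u)"
    using h k by (intro nn_integral_cong, subst prod_ennreal) (auto simp: prod_dividef less_imp_le)
  also have "\<dots> = (\<Prod>d\<in>{1..D}. \<integral>\<^sup>+y. ennreal (h d y / k d) \<partial>Mker m t (u d))"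
    unfolding Mvec_def using h prob_space_Mker[OF t]
    by (intro nn_integral_PiM_prod_prob) (auto intro!: borel_measurable_divide dest: borel_measurable_integrable)
  also have "\<dots> = (\<Prod>d\<in>{1..D}. ennreal (Mop m t (h d) (u d) / k d))"
  proof (rule prod.cong[OF refl])
    fix d assume "d \<in> {1..D}"
    then show "(\<integral>\<^sup>+y. ennreal (h d y / k d) \<partial>Mker m t (u d)) = ennreal (Mop m t (h d) (u d) / k d)"
      using h k[of d] by (subst nn_integral_eq_integral) (auto simp: Mop_def less_imp_le)
  qed
  also have "\<dots> \<le> (\<Prod>d\<in>{1..D}. ennreal (exp (- (ln (k d) - ln (Mop m t (h d) (u d))))))"
    using h k by (intro prod_mono_ennreal ennreal_leI ratio_le_exp_ln_diff) (auto simp: Mop_def intro!: integral_nonneg)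
  also have "\<dots> = ennreal (exp (- (\<Sum>d=1..D. ln (k d) - ln (Mop m t (h d) (u d)))))"
    by (subst prod_ennreal) (simp_all add: exp_sum sum_negf[symmetric])
  finally show ?thesis .
qed

text \<open>By linearity only the marginal law of each free particle enters; the sum starts at
  \<open>1\<close> because particle \<open>0\<close> is fixed.\<close>

lemma nn_integral_step_law_sum:
  assumes t: "t \<ge> 1" and xt: "x t \<in> space (vec_space D)" and \<phi>: "\<phi> \<in> borel_measurable (vec_space D)"
  shows "(\<integral>\<^sup>+z. (\<Sum>l=1..N. \<phi> (z l)) \<partial>step_law N D x t) = of_nat N * (\<integral>\<^sup>+y. \<phi> y \<partial>Mvec m D t (parent x t))"
proof -
  let ?K = "Mvec m D t (parent x t)"
  define M where "M n = (if n = 0 then return (vec_space D) (x t) else ?K)" for n :: nat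
  have law: "step_law N D x t = PiM {0..N} M"
    unfolding step_law_def mutate_def M_def[abs_def] ..
  have prob: "prob_space (M n)" for n
    using xt prob_space_Mvec[OF t] by (auto simp: M_def intro: prob_space_return)
  have comp: "(\<lambda>z. z l) \<in> step_law N D x t \<rightarrow>\<^sub>M ?K" "distr (step_law N D x t) ?K (\<lambda>z. z l) = ?K"
    if "l \<in> {1..N}" for l
  proof -
    have l: "l \<in> {0..N}" "M l = ?K" using that by (auto simp: M_def)
    show "(\<lambda>z. z l) \<in> step_law N D x t \<rightarrow>\<^sub>M ?K"
      using measurable_component_singleton[OF l(1), of M] unfolding law l(2) .
    show "distr (step_law N D x t) ?K (\<lambda>z. z l) = ?K"
      using distr_PiM_component[of "{0..N}" M l, OF prob l(1)] unfolding law l(2) .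
  qed
  have \<phi>': "\<phi> \<in> borel_measurable ?K"
    using \<phi> unfolding measurable_cong_sets[OF sets_Mvec refl] .
  have eq: "(\<integral>\<^sup>+z. \<phi> (z l) \<partial>step_law N D x t) = (\<integral>\<^sup>+y. \<phi> y \<partial>?K)" if "l \<in> {1..N}" for l
    using nn_integral_distr[OF comp(1)[OF that], of \<phi>] \<phi>' unfolding comp(2)[OF that] by simp
  have "(\<lambda>z. \<phi> (z l)) \<in> borel_measurable (step_law N D x t)" if "l \<in> {1..N}" for l
    using comp(1)[OF that] \<phi>' by (rule measurable_compose)
  then have "(\<integral>\<^sup>+z. (\<Sum>l=1..N. \<phi> (z l)) \<partial>step_law N D x t) = (\<Sum>l=1..N. \<integral>\<^sup>+z. \<phi> (z l) \<partial>step_law N D x t)"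
    by (rule nn_integral_sum)
  also have "\<dots> = (\<Sum>l=1..N. \<integral>\<^sup>+y. \<phi> y \<partial>?K)"
    by (rule sum.cong[OF refl eq])
  finally show ?thesis by simp
qed

lemma AE_step_law_reference:
  assumes t: "t \<ge> 1" and xt: "x t \<in> space (vec_space D)"
  shows "AE z in step_law N D x t. z 0 = x t"
  unfolding step_law_def mutate_def
proof (rule AE_PiM_component)
  have "Measurable.pred (vec_space D) (\<lambda>y. y = x t)"
  proof -
    have "{y \<in> space (vec_space D). y = x t} = {x t}" using xt by auto
    then show ?thesis using singleton_in_sets_vec_space[OF xt] by (simp add: pred_def)
  qed
  then show "AE y in if (0::nat) = 0 then return (vec_space D) (x t) else Mvec m D t (parent x t). y = x t"
    using xt by (simp add: AE_return)
qed (use xt prob_space_Mvec[OF t] in \<open>auto intro: prob_space_return\<close>)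

text \<open>A pointwise lower bound on the selection probability \<open>f\<close> is integrated
  against a probability measure; the loss stays on the right as a summand, since subtraction in
  \<open>ennreal\<close> truncates.\<close>

lemma step_mass_ge:
  assumes x: "x \<in> space (path_space T D)" and t: "t \<in> {1..T}"
    and f: "f \<in> borel_measurable (particle_space N D)" and \<phi>: "\<phi> \<in> borel_measurable (vec_space D)"
    and ge: "\<And>z. z 0 = x t \<Longrightarrow> 1 \<le> f z + (\<Sum>l=1..N. \<phi> (z l))"
    and \<epsilon>: "(\<integral>\<^sup>+y. \<phi> y \<partial>Mvec m D t (parent x t)) \<le> ennreal \<epsilon>" "0 \<le> \<epsilon>"
  shows "1 \<le> (\<integral>\<^sup>+z. f z \<partial>step_law N D x t) + ennreal (N * \<epsilon>)"
proof -
  have S: "prob_space (step_law N D x t)" "sets (step_law N D x t) = sets (particle_space N D)"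
    using step_law_in_prob_algebra[OF x t] by (auto simp: space_prob_algebra)
  have xt: "t \<ge> 1" "x t \<in> space (vec_space D)" using t path_in_vec_space[OF x t] by auto
  have meas: "(\<lambda>z. \<Sum>l=1..N. \<phi> (z l)) \<in> borel_measurable (particle_space N D)"
    unfolding particle_space_def
    by (intro borel_measurable_sum measurable_compose[OF _ \<phi>] measurable_component_singleton) auto
  have "1 = (\<integral>\<^sup>+z. 1 \<partial>step_law N D x t)"
    using prob_space.emeasure_space_1[OF S(1)] by simp
  also have "\<dots> \<le> (\<integral>\<^sup>+z. f z + (\<Sum>l=1..N. \<phi> (z l)) \<partial>step_law N D x t)"
  proof (rule nn_integral_mono_AE)
    show "AE z in step_law N D x t. 1 \<le> f z + (\<Sum>l=1..N. \<phi> (z l))"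
      using AE_step_law_reference[of t x D N, OF xt] by eventually_elim (rule ge)
  qed
  also have "\<dots> = (\<integral>\<^sup>+z. f z \<partial>step_law N D x t) + (\<integral>\<^sup>+z. (\<Sum>l=1..N. \<phi> (z l)) \<partial>step_law N D x t)"
    using f meas S(2) by (intro nn_integral_add) (simp_all cong: measurable_cong_sets)
  also have "(\<integral>\<^sup>+z. (\<Sum>l=1..N. \<phi> (z l)) \<partial>step_law N D x t) \<le> of_nat N * ennreal \<epsilon>"
    unfolding nn_integral_step_law_sum[where x=x and t=t and \<phi>=\<phi>, OF xt \<phi>] by (intro mult_left_mono \<epsilon>) simp
  also have "of_nat N * ennreal \<epsilon> = ennreal (N * \<epsilon>)"
    by (simp add: ennreal_mult'' \<epsilon> ennreal_of_nat_eq_real_of_nat)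
  finally show ?thesis by (simp add: add_left_mono)
qed

text \<open>\<open>e\<close> bounds the expected weight of a fresh particle relative to that of the reference particle.\<close>

definition dominant :: "bool \<Rightarrow> nat \<Rightarrow> nat \<Rightarrow> real \<Rightarrow> (nat \<Rightarrow> nat \<Rightarrow> real) \<Rightarrow> bool" where
  "dominant bs T D e x \<longleftrightarrow> x \<in> space (path_space T D) \<and>
     (\<forall>t\<in>{1..T}. (\<integral>\<^sup>+y. ennreal (Gvec G D t y / Gvec G D t (x t)) \<partial>Mvec m D t (parent x t)) \<le> ennreal e) \<and>
     (bs \<longrightarrow> (\<forall>t\<in>{1..T-1}. 0 < mvec m D (t + 1) (x t) (x (t + 1)) \<and>
        (\<integral>\<^sup>+y. ennreal (Gvec G D t y * mvec m D (t + 1) y (x (t + 1)) /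
           (Gvec G D t (x t) * mvec m D (t + 1) (x t) (x (t + 1)))) \<partial>Mvec m D t (parent x t)) \<le> ennreal e))"

lemma step_mass_intermediate:
  assumes dom: "dominant bs T D e x" and e: "0 \<le> e" and N: "N \<ge> 1" and t: "t \<in> {1..<T}"
  shows "1 \<le> (\<integral>\<^sup>+z. keep bs fm N D T x t z * indicator {x t} (z 0) * survive N D t z \<partial>step_law N D x t)
    + ennreal (2 * (real N)\<^sup>2 * e)"
proof -
  have x: "x \<in> space (path_space T D)" and t': "t \<in> {1..T}" "t \<ge> 1" "t \<noteq> T"
    using dom t by (auto simp: dominant_def)
  have xt: "x t \<in> space (vec_space D)" "x (t + 1) \<in> space (vec_space D)"
    using path_in_vec_space[OF x] t by auto
  define g where "g y = Gvec G D t y" for y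
  define k where "k y = g y * mvec m D (t + 1) y (x (t + 1))" for y
  have g: "0 < g y" for y using t' by (simp add: g_def Gvec_pos)
  have k: "0 \<le> k y" for y using g[of y] mvec_nonneg[of "t + 1" D y "x (t + 1)"] by (simp add: k_def)
  have kx: "0 < k (x t)" if bs using dom t that g by (auto simp: k_def dominant_def)
  have [measurable]: "g \<in> borel_measurable (vec_space D)" "k \<in> borel_measurable (vec_space D)"
    using t' xt unfolding g_def[abs_def] k_def[abs_def]
    by (auto intro!: borel_measurable_times measurable_mvec[where f="\<lambda>y. y"])
  \<comment> \<open>Summed over the free particles this is the loss \<open>N * a + b\<close> of
    \<open>inverse_one_plus_power_ge\<close>; the factor \<open>N\<close> counts the ancestors that
    must all choose \<open>0\<close>.\<close>
  define \<phi> where "\<phi> y = N * ennreal (g y / g (x t)) + (if bs then ennreal (k y / k (x t)) else 0)" for y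
  have \<phi>_meas: "\<phi> \<in> borel_measurable (vec_space D)" unfolding \<phi>_def by measurable
  have "(\<integral>\<^sup>+y. \<phi> y \<partial>Mvec m D t (parent x t)) = N * (\<integral>\<^sup>+y. ennreal (g y / g (x t)) \<partial>Mvec m D t (parent x t))
      + (if bs then \<integral>\<^sup>+y. ennreal (k y / k (x t)) \<partial>Mvec m D t (parent x t) else 0)"
    unfolding \<phi>_def by (cases bs) (simp_all add: nn_integral_add nn_integral_cmult)
  also have "\<dots> \<le> N * ennreal e + ennreal e"
    using dom t t' by (intro add_mono mult_left_mono) (auto simp: dominant_def g_def k_def)
  also have "\<dots> = ennreal ((N + 1) * e)"
    using e by (simp add: ennreal_of_nat_eq_real_of_nat ennreal_mult''[symmetric] distrib_right)
  finally have \<phi>_int: "(\<integral>\<^sup>+y. \<phi> y \<partial>Mvec m D t (parent x t)) \<le> ennreal ((N + 1) * e)" .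
  have "1 \<le> (\<integral>\<^sup>+z. keep bs fm N D T x t z * indicator {x t} (z 0) * survive N D t z \<partial>step_law N D x t)
    + ennreal (N * ((N + 1) * e))"
  proof (rule step_mass_ge[OF x t'(1) _ \<phi>_meas _ \<phi>_int])
    have "(\<lambda>z. indicator {x t} (z 0) :: ennreal) \<in> borel_measurable (particle_space N D)"
      unfolding particle_space_def
      by (intro measurable_compose[OF measurable_component_singleton] borel_measurable_indicator singleton_in_sets_vec_space xt) auto
    then show "(\<lambda>z. keep bs fm N D T x t z * indicator {x t} (z 0) * survive N D t z) \<in> borel_measurable (particle_space N D)"
      using measurable_keep[OF x t'(1)] measurable_survive[OF t'(2)] by (intro borel_measurable_times_ennreal)
  next
    fix z :: "nat \<Rightarrow> nat \<Rightarrow> real" assume z: "z 0 = x t"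
    define a where "a = (\<Sum>l=1..N. g (z l) / g (x t))"
    define b where "b = (if bs then (\<Sum>l=1..N. k (z l) / k (x t)) else 0)"
    have a: "0 \<le> a" unfolding a_def using g by (intro sum_nonneg divide_nonneg_nonneg) (auto simp: less_imp_le)
    have b: "0 \<le> b" unfolding b_def using k by (auto intro!: sum_nonneg divide_nonneg_nonneg)
    have S: "survive N D t z = ennreal ((1 / (1 + a)) ^ N)"
      unfolding survive_def a_def using relative_weight_0[of "\<lambda>l. g (z l)" N] g[of "z 0"] z by (simp add: g_def)
    have K: "keep bs fm N D T x t z = ennreal (1 / (1 + b))"
      unfolding keep_def b_def
      using t' relative_weight_0[of "\<lambda>l. k (z l)" N] kx z
      by (simp add: emeasure_weighted_index_law_0 k_def g_def)
    have "(\<Sum>l=1..N. \<phi> (z l)) = (\<Sum>l=1..N. ennreal (N * (g (z l) / g (x t)) + (if bs then k (z l) / k (x t) else 0)))"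
      unfolding \<phi>_def using k g[of "x t"] g
      by (intro sum.cong) (auto simp: ennreal_of_nat_eq_real_of_nat ennreal_mult''[symmetric] ennreal_plus[symmetric] less_imp_le
          simp del: ennreal_plus)
    also have "\<dots> = ennreal (\<Sum>l=1..N. N * (g (z l) / g (x t)) + (if bs then k (z l) / k (x t) else 0))"
      using k g by (intro sum_ennreal) (auto intro!: add_nonneg_nonneg mult_nonneg_nonneg divide_nonneg_nonneg simp: less_imp_le)
    also have "(\<Sum>l=1..N. N * (g (z l) / g (x t)) + (if bs then k (z l) / k (x t) else 0)) = N * a + b"
      by (simp add: sum.distrib a_def b_def sum_distrib_left)
    finally have \<phi>z: "(\<Sum>l=1..N. \<phi> (z l)) = ennreal (N * a + b)" .
    have "1 \<le> 1 / (1 + b) * (1 / (1 + a)) ^ N + (N * a + b)"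
      using inverse_one_plus_power_ge[OF a b, of N] by simp
    then have "ennreal 1 \<le> ennreal (1 / (1 + b) * (1 / (1 + a)) ^ N + (N * a + b))"
      by (rule ennreal_leI)
    also have "\<dots> = ennreal (1 / (1 + b) * (1 / (1 + a)) ^ N) + ennreal (N * a + b)"
      using a b by (intro ennreal_plus) auto
    also have "ennreal (1 / (1 + b) * (1 / (1 + a)) ^ N) = ennreal (1 / (1 + b)) * ennreal ((1 / (1 + a)) ^ N)"
      using a b by (intro ennreal_mult) auto
    finally have "1 \<le> ennreal (1 / (1 + b)) * ennreal ((1 / (1 + a)) ^ N) + ennreal (N * a + b)"
      by simp
    then show "1 \<le> keep bs fm N D T x t z * indicator {x t} (z 0) * survive N D t z + (\<Sum>l=1..N. \<phi> (z l))"
      unfolding \<phi>z S K using z by simp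
  qed (use e in auto)
  \<comment> \<open>The constant \<open>2\<close> arises here: \<open>N + 1\<close> is at most
    \<open>2 * N\<close> because \<open>N \<ge> 1\<close>.\<close>
  also have "N * ((N + 1) * e) \<le> 2 * (real N)\<^sup>2 * e"
  proof -
    have "real N * (real N + 1) \<le> real N * (2 * real N)" using N by (intro mult_left_mono) auto
    then have "real N * (real N + 1) * e \<le> real N * (2 * real N) * e" using e by (rule mult_right_mono)
    then show ?thesis by (simp add: power2_eq_square algebra_simps)
  qed
  finally show ?thesis by (simp add: add_left_mono ennreal_leI)
qed

text \<open>No resampling follows time \<open>T\<close>, so the loss is only \<open>N * e\<close>;
  relaxing it to the loss of the other times lets all \<open>T\<close> factors share one
  constant.\<close>

lemma step_mass_final:
  assumes dom: "dominant bs T D e x" and e: "0 \<le> e" and N: "N \<ge> 1" and T: "T \<ge> 1"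
  shows "1 \<le> (\<integral>\<^sup>+z. keep bs fm N D T x T z * indicator {x T} (z 0) \<partial>step_law N D x T)
    + ennreal (2 * (real N)\<^sup>2 * e)"
proof -
  have x: "x \<in> space (path_space T D)" and t': "T \<in> {1..T}"
    using dom T by (auto simp: dominant_def)
  have xt: "x T \<in> space (vec_space D)"
    using path_in_vec_space[OF x t'] .
  define g where "g y = Gvec G D T y" for y
  have g: "0 < g y" for y using T by (simp add: g_def Gvec_pos)
  have [measurable]: "g \<in> borel_measurable (vec_space D)"
    using T unfolding g_def[abs_def] by simp
  define \<phi> where "\<phi> y = ennreal (g y / g (x T))" for y
  have \<phi>_meas: "\<phi> \<in> borel_measurable (vec_space D)" unfolding \<phi>_def by measurable
  have \<phi>_int: "(\<integral>\<^sup>+y. \<phi> y \<partial>Mvec m D T (parent x T)) \<le> ennreal e"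
    using dom t' by (auto simp: dominant_def g_def \<phi>_def)
  have "1 \<le> (\<integral>\<^sup>+z. keep bs fm N D T x T z * indicator {x T} (z 0) \<partial>step_law N D x T) + ennreal (N * e)"
  proof (rule step_mass_ge[OF x t' _ \<phi>_meas _ \<phi>_int e])
    have "(\<lambda>z. indicator {x T} (z 0) :: ennreal) \<in> borel_measurable (particle_space N D)"
      unfolding particle_space_def
      by (intro measurable_compose[OF measurable_component_singleton] borel_measurable_indicator singleton_in_sets_vec_space xt) auto
    then show "(\<lambda>z. keep bs fm N D T x T z * indicator {x T} (z 0)) \<in> borel_measurable (particle_space N D)"
      using measurable_keep[OF x t'] by (intro borel_measurable_times_ennreal)
  next
    fix z :: "nat \<Rightarrow> nat \<Rightarrow> real" assume z: "z 0 = x T"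
    let ?h = "\<lambda>n. ln (Gvec G D T (z n)) - ln (Gvec G D T (z 0))"
    let ?s = "(if fm then Phi else Psi) N ?h 0"
    have h: "exp (?h n) = g (z n) / g (x T)" for n
      using T z by (simp add: exp_diff g_def Gvec_pos)
    have "1 \<le> ?s + (\<Sum>n=1..N. g (z n) / g (x T))"
      using selection_0_ge[where N=N and h="?h" and fm=fm] unfolding h by linarith
    then have "ennreal 1 \<le> ennreal ?s + ennreal (\<Sum>n=1..N. g (z n) / g (x T))"
      using g selection_nonneg_sum_le(1)[where fm=fm and N=N and h="?h" and n=0]
      by (subst ennreal_plus[symmetric]) (auto intro!: ennreal_leI sum_nonneg divide_nonneg_nonneg simp: less_imp_le)
    also have "ennreal (\<Sum>n=1..N. g (z n) / g (x T)) = (\<Sum>l=1..N. \<phi> (z l))"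
      unfolding \<phi>_def using g by (intro sum_ennreal[symmetric]) (auto simp: less_imp_le)
    also have "ennreal ?s = keep bs fm N D T x T z"
      by (simp add: keep_def final_index_law_def emeasure_index_law)
    finally show "1 \<le> keep bs fm N D T x T z * indicator {x T} (z 0) + (\<Sum>l=1..N. \<phi> (z l))"
      using z by simp
  qed
  also have "N * e \<le> 2 * (real N)\<^sup>2 * e"
  proof -
    have "real N * 1 \<le> real N * (2 * real N)" using N by (intro mult_left_mono) auto
    then have "real N * 1 * e \<le> real N * (2 * real N) * e" using e by (rule mult_right_mono)
    then show ?thesis by (simp add: power2_eq_square mult_ac)
  qed
  finally show ?thesis by (simp add: add_left_mono ennreal_leI)
qed

lemma icsmc_dist_dominant:
  assumes dom: "dominant bs T D e x" and e: "0 \<le> e" and N: "N \<ge> 1" and T: "T \<ge> 1"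
  shows "icsmc_dist bs fm m G N T D x \<in> {0..2 * real T * (real N)\<^sup>2 * e}"
proof -
  have x: "x \<in> space (path_space T D)" using dom by (simp add: dominant_def)
  let ?\<delta> = "2 * (real N)\<^sup>2 * e"
  let ?I = "\<lambda>s. if s = T then \<integral>\<^sup>+z. keep bs fm N D T x T z * indicator {x T} (z 0) \<partial>step_law N D x T
    else \<integral>\<^sup>+z. keep bs fm N D T x s z * indicator {x s} (z 0) * survive N D s z \<partial>step_law N D x s"
  have split: "{1..T} = insert T {1..<T}" using T by auto
  have "ennreal (1 - card {1..T} * ?\<delta>) \<le> (\<Prod>s\<in>{1..T}. ?I s)"
    using step_mass_intermediate[OF dom e N] step_mass_final[OF dom e N T] e
    by (intro power_ge_of_one_le_add) auto
  also have "\<dots> = (\<Prod>s\<in>{1..<T}. ?I s) * ?I T"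
    unfolding split by (subst prod.insert) (auto simp: mult.commute)
  also have "(\<Prod>s\<in>{1..<T}. ?I s) = (\<Prod>s\<in>{1..<T}. \<integral>\<^sup>+z. keep bs fm N D T x s z * indicator {x s} (z 0) * survive N D s z \<partial>step_law N D x s)"
    by (intro prod.cong) auto
  also have "\<dots> * ?I T \<le> emeasure (icsmc_indices_law bs fm m G N T D x) {(zero_ancestors N T, \<lambda>s\<in>{1..T}. 0)}"
    using icsmc_indices_law_zero_ge[OF T x] by simp
  finally have "icsmc_dist bs fm m G N T D x \<in> {0..1 - (1 - card {1..T} * ?\<delta>)}"
    by (rule icsmc_dist_le[OF T x])
  then show ?thesis by (simp add: mult_ac)
qed

subsection \<open>Typical reference paths\<close>

lemma sets_fk_target: "sets (fk_target m G T) = sets (PiM {1..T} (\<lambda>_. borel))"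
  unfolding fk_target_def sets_density by (intro sets_PiM_cong) auto

text \<open>For \<open>t = 1\<close> the value \<open>y 0\<close> is not a coordinate of the product
  space; since \<open>m 1\<close> ignores it, the constant \<open>0\<close> takes its place.\<close>

lemma measurable_transition_density:
  assumes "t \<in> {1..T}"
  shows "(\<lambda>y. m t (y (t - 1)) (y t)) \<in> borel_measurable (PiM {1..T} (\<lambda>_. lborel))"
proof -
  have comp: "(\<lambda>y. y s) \<in> borel_measurable (PiM {1..T} (\<lambda>_. lborel :: real measure))" if "s \<in> {1..T}" for s
    using measurable_component_singleton[OF that, of "\<lambda>_. lborel :: real measure"]
    unfolding measurable_cong_sets[OF refl sets_lborel] .
  show ?thesis
  proof (cases "t = 1")
    case True
    have "(\<lambda>y. m t (y (t - 1)) (y t)) = (\<lambda>y. m 1 0 (y 1))"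
      unfolding True by (intro ext fun_cong[OF m_initial])
    moreover have "(\<lambda>y. m 1 0 (y 1)) \<in> borel_measurable (PiM {1..T} (\<lambda>_. lborel))"
      using assms True by (intro measurable_compose[OF comp measurable_density_section]) auto
    ultimately show ?thesis by (simp only:)
  next
    case False
    then have "t - 1 \<in> {1..T}" "1 \<le> t" using assms by auto
    from measurable_compose[OF measurable_Pair[OF comp[OF this(1)] comp[OF assms]] m_measurable[OF this(2)]]
    show ?thesis by (simp only: prod.case)
  qed
qed

text \<open>The density of the target has every transition density as a factor, so it vanishes
  wherever one of them does.\<close>

lemma AE_fk_target_transition_pos:
  "AE y in fk_target m G T. \<forall>t\<in>{1..T}. 0 < m t (y (t - 1)) (y t)"
proof -
  let ?L = "PiM {1..T} (\<lambda>_. lborel :: real measure)"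
  have "(\<lambda>y. G t (y t)) \<in> borel_measurable ?L" if "t \<in> {1..T}" for t
    using that measurable_component_singleton[of t "{1..T}" "\<lambda>_. lborel :: real measure"]
    by (intro measurable_compose[OF _ G_measurable]) auto
  then have "fk_weight m G T \<in> borel_measurable ?L"
    unfolding fk_weight_def[abs_def]
    by (intro borel_measurable_prod borel_measurable_times measurable_transition_density)
  then have "(\<lambda>y. ennreal (fk_weight m G T y) / fk_norm m G T) \<in> borel_measurable ?L"
    by measurable
  moreover have "0 < m t (y (t - 1)) (y t)" if "0 < ennreal (fk_weight m G T y) / fk_norm m G T" "t \<in> {1..T}" for y t
  proof (rule ccontr)
    assume "\<not> 0 < m t (y (t - 1)) (y t)"
    then have "m t (y (t - 1)) (y t) = 0" using m_nonneg[of t "y (t - 1)" "y t"] that(2) by auto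
    then have "fk_weight m G T y = 0" unfolding fk_weight_def using that(2) by (intro prod_zero) auto
    then show False using that(1) by simp
  qed
  ultimately show ?thesis
    unfolding fk_target_def by (subst AE_density) (blast intro: AE_I2)+
qed

text \<open>Its mean under the target is \<open>r_value m G T t\<close>. Minus its sum over the
  columns is the exponent in the bound on the expected relative resampling weight.\<close>

definition log_ratio :: "nat \<Rightarrow> (nat \<Rightarrow> real) \<Rightarrow> real" where
  "log_ratio t y = ln (G t (y t)) - ln (Mop m t (G t) (y (t - 1)))"

definition log_ratio_bs :: "nat \<Rightarrow> (nat \<Rightarrow> real) \<Rightarrow> real" where
  "log_ratio_bs t y = ln (G t (y t)) + ln (m (t + 1) (y t) (y (t + 1))) -
     ln (Mop m t (\<lambda>z. G t z * m (t + 1) z (y (t + 1))) (y (t - 1)))"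

text \<open>What a single column must satisfy for the log-ratios to be genuine: no divergent
  integral behind \<open>Mop\<close>, no vanishing transition density behind
  \<open>ln\<close>.\<close>

definition regular :: "bool \<Rightarrow> nat \<Rightarrow> (nat \<Rightarrow> real) \<Rightarrow> bool" where
  "regular bs T y \<longleftrightarrow> (\<forall>t\<in>{1..T}. integrable (Mker m t (y (t - 1))) (G t)) \<and>
     (bs \<longrightarrow> (\<forall>t\<in>{1..T-1}. 0 < m (t + 1) (y t) (y (t + 1)) \<and>
        integrable (Mker m t (y (t - 1))) (\<lambda>z. G t z * m (t + 1) z (y (t + 1)))))"

text \<open>For \<open>t = 1\<close> the two arguments may differ, one being the dummy
  \<open>0\<close> and the other the value of the restriction outside its domain, but the initial
  kernel does not see them.\<close>

lemma Mker_parent: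
  assumes "t \<in> {1..T}"
  shows "Mker m t (parent x t d) = Mker m t ((\<lambda>s\<in>{1..T}. x s d) (t - 1))"
proof (cases "t = 1")
  case True
  show ?thesis unfolding Mker_def True
    by (subst m_initial[of _ "(\<lambda>s\<in>{1..T}. x s d) (1 - 1)"]) (rule refl)
next
  case False
  then have "(\<lambda>s\<in>{1..T}. x s d) (t - 1) = parent x t d" using assms by (auto simp: parent_def)
  then show ?thesis by simp
qed

text \<open>The expectations in \<open>dominant\<close> factor over the coordinates, so sums of
  log-ratios over the columns govern them. Here \<open>c\<close> is the level of the whole sum; the
  theorem takes a multiple of \<open>D\<close> for it.\<close>

lemma dominant_of_columns:
  assumes x: "x \<in> space (path_space T D)"
    and reg: "\<And>d. d \<in> {1..D} \<Longrightarrow> regular bs T (\<lambda>s\<in>{1..T}. x s d)"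
    and r: "\<And>t. t \<in> {1..T} \<Longrightarrow> c \<le> (\<Sum>d=1..D. log_ratio t (\<lambda>s\<in>{1..T}. x s d))"
    and b: "\<And>t. bs \<Longrightarrow> t \<in> {1..T-1} \<Longrightarrow> c \<le> (\<Sum>d=1..D. log_ratio_bs t (\<lambda>s\<in>{1..T}. x s d))"
  shows "dominant bs T D (exp (- c)) x"
  unfolding dominant_def
proof (intro conjI ballI impI x)
  let ?y = "\<lambda>d. \<lambda>s\<in>{1..T}. x s d"
  fix t assume t: "t \<in> {1..T}"
  have "(\<integral>\<^sup>+y. ennreal (Gvec G D t y / Gvec G D t (x t)) \<partial>Mvec m D t (parent x t)) \<le>
      ennreal (exp (- (\<Sum>d=1..D. ln (G t (x t d)) - ln (Mop m t (G t) (parent x t d)))))"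
    unfolding Gvec_def using t reg
    by (intro nn_integral_Mvec_ratio_le) (auto simp: G_pos less_imp_le regular_def Mker_parent[of t T])
  also have "(\<Sum>d=1..D. ln (G t (x t d)) - ln (Mop m t (G t) (parent x t d))) = (\<Sum>d=1..D. log_ratio t (?y d))"
    using t by (intro sum.cong) (auto simp: log_ratio_def Mop_def Mker_parent[of t T])
  also have "ennreal (exp (- \<dots>)) \<le> ennreal (exp (- c))"
    using r[OF t] by (intro ennreal_leI) auto
  finally show "(\<integral>\<^sup>+y. ennreal (Gvec G D t y / Gvec G D t (x t)) \<partial>Mvec m D t (parent x t)) \<le> ennreal (exp (- c))" .
next
  let ?y = "\<lambda>d. \<lambda>s\<in>{1..T}. x s d"
  fix t assume bs: bs and t: "t \<in> {1..T-1}"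
  then have t': "t \<in> {1..T}" "t + 1 \<in> {1..T}" "t \<ge> 1" by auto
  have y: "?y d t = x t d" "?y d (t + 1) = x (t + 1) d" for d
    using t' by auto
  have mpos: "0 < m (t + 1) (x t d) (x (t + 1) d)" if "d \<in> {1..D}" for d
    using reg[OF that] bs t unfolding regular_def y[symmetric] by blast
  have int: "integrable (Mker m t (parent x t d)) (\<lambda>z. G t z * m (t + 1) z (x (t + 1) d))" if "d \<in> {1..D}" for d
    using reg[OF that] bs t unfolding regular_def y(2)[symmetric] Mker_parent[OF t'(1)] by blast
  show "0 < mvec m D (t + 1) (x t) (x (t + 1))"
    unfolding mvec_def using mpos by (intro prod_pos) auto
  have "(\<integral>\<^sup>+y. ennreal (Gvec G D t y * mvec m D (t + 1) y (x (t + 1)) /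
           (Gvec G D t (x t) * mvec m D (t + 1) (x t) (x (t + 1)))) \<partial>Mvec m D t (parent x t))
    \<le> ennreal (exp (- (\<Sum>d=1..D. ln (G t (x t d) * m (t + 1) (x t d) (x (t + 1) d)) -
         ln (Mop m t (\<lambda>z. G t z * m (t + 1) z (x (t + 1) d)) (parent x t d)))))"
    unfolding Gvec_def mvec_def prod.distrib[symmetric] using t' int mpos
    by (intro nn_integral_Mvec_ratio_le) (auto simp: G_pos m_nonneg less_imp_le)
  also have "(\<Sum>d=1..D. ln (G t (x t d) * m (t + 1) (x t d) (x (t + 1) d)) -
         ln (Mop m t (\<lambda>z. G t z * m (t + 1) z (x (t + 1) d)) (parent x t d))) = (\<Sum>d=1..D. log_ratio_bs t (?y d))"
  proof (rule sum.cong[OF refl])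
    fix d assume d: "d \<in> {1..D}"
    \<comment> \<open>The logarithm of the product may be split because the transition density is
      positive; with \<open>ln 0 = 0\<close> this would fail in general.\<close>
    show "ln (G t (x t d) * m (t + 1) (x t d) (x (t + 1) d)) -
         ln (Mop m t (\<lambda>z. G t z * m (t + 1) z (x (t + 1) d)) (parent x t d)) = log_ratio_bs t (?y d)"
      unfolding log_ratio_bs_def Mop_def Mker_parent[OF t'(1)] y
      using mpos[OF d] G_pos[OF t'(3)] by (subst ln_mult_pos) auto
  qed
  also have "ennreal (exp (- \<dots>)) \<le> ennreal (exp (- c))"
    using b[OF bs t] by (intro ennreal_leI) auto
  finally show "(\<integral>\<^sup>+y. ennreal (Gvec G D t y * mvec m D (t + 1) y (x (t + 1)) /
           (Gvec G D t (x t) * mvec m D (t + 1) (x t) (x (t + 1)))) \<partial>Mvec m D t (parent x t)) \<le> ennreal (exp (- c))" .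
qed

end

theorem proposition2p2:
  fixes m :: "nat \<Rightarrow> real \<Rightarrow> real \<Rightarrow> real" and G :: "nat \<Rightarrow> real \<Rightarrow> real"
    and T :: nat and bs fm :: bool
  assumes model: "feynman_kac_model m G"
    and T: "T \<ge> 1"
    and target: "prob_space (fk_target m G T)"
    and r_def: "\<And>t. t \<in> {1..T} \<Longrightarrow> r_defined m G T t"
    and r_pos: "(INF t\<in>{1..T}. ereal (r_value m G T t)) > 0"
    and b_def: "\<And>t. bs \<Longrightarrow> t \<in> {1..T - 1} \<Longrightarrow> b_defined m G T t"
    and b_pos: "bs \<Longrightarrow> (INF t\<in>{1..T - 1}. ereal (b_value m G T t)) > 0"
  shows "\<exists>F :: nat \<Rightarrow> (nat \<Rightarrow> nat \<Rightarrow> real) set.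
           (\<forall>D\<ge>1. F D \<in> sets (path_space T D)) \<and>
           (\<lambda>D. measure (fk_target_prod m G T D) (F D)) \<longlonglongrightarrow> 1 \<and>
           (\<forall>N :: nat \<Rightarrow> nat.
              (\<forall>D\<ge>1. N D \<ge> 1) \<and> (\<lambda>D. ln (real (N D))) \<in> o(\<lambda>D. real D) \<longrightarrow>
              (\<lambda>D. SUP x\<in>F D. icsmc_dist bs fm m G (N D) T D x) \<longlonglongrightarrow> 0)"
proof -
  interpret feynman_kac_model m G by fact
  let ?M = "fk_target m G T"
  let ?y = "\<lambda>x d. \<lambda>t\<in>{1..T}. x t d"
  have r_int: "integrable ?M (log_ratio t)" "0 < (\<integral>y. log_ratio t y \<partial>?M)" if t: "t \<in> {1..T}" for t
  proof -
    have i: "integrable ?M (\<lambda>y. ln (G t (y t)))" "integrable ?M (\<lambda>y. ln (Mop m t (G t) (y (t - 1))))"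
      using r_def[OF t] by (auto simp: r_defined_def)
    then show "integrable ?M (log_ratio t)" unfolding log_ratio_def[abs_def] by (rule Bochner_Integration.integrable_diff)
    have "(\<integral>y. log_ratio t y \<partial>?M) = r_value m G T t"
      unfolding log_ratio_def r_value_def using i by (rule Bochner_Integration.integral_diff)
    then show "0 < (\<integral>y. log_ratio t y \<partial>?M)"
      using less_INF_D[OF r_pos t] by simp
  qed
  have b_int: "integrable ?M (log_ratio_bs t)" "0 < (\<integral>y. log_ratio_bs t y \<partial>?M)" if bs and t: "t \<in> {1..T-1}" for t
  proof -
    have i: "integrable ?M (\<lambda>x. ln (G t (x t)) + ln (m (t + 1) (x t) (x (t + 1))))"
      "integrable ?M (\<lambda>x. ln (Mop m t (\<lambda>y. G t y * m (t + 1) y (x (t + 1))) (x (t - 1))))"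
      using b_def[OF that] by (auto simp: b_defined_def)
    then show "integrable ?M (log_ratio_bs t)" unfolding log_ratio_bs_def[abs_def] by (rule Bochner_Integration.integrable_diff)
    have "(\<integral>y. log_ratio_bs t y \<partial>?M) = b_value m G T t"
      unfolding log_ratio_bs_def b_value_def using i by (rule Bochner_Integration.integral_diff)
    then show "0 < (\<integral>y. log_ratio_bs t y \<partial>?M)"
      using less_INF_D[OF b_pos[OF \<open>bs\<close>] t] by simp
  qed
  define \<Xi> where "\<Xi> = log_ratio ` {1..T} \<union> (if bs then log_ratio_bs ` {1..T-1} else {})"
  have \<Xi>: "finite \<Xi>" "\<Xi> \<noteq> {}" "\<And>\<xi>. \<xi> \<in> \<Xi> \<Longrightarrow> integrable ?M \<xi>" "\<And>\<xi>. \<xi> \<in> \<Xi> \<Longrightarrow> 0 < (\<integral>y. \<xi> y \<partial>?M)"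
    using r_int b_int T by (auto simp: \<Xi>_def split: if_splits)
  \<comment> \<open>Half the smallest mean lies strictly between \<open>0\<close> and every mean;
    the minimum exists because \<open>\<Xi>\<close> is finite and, by \<open>T \<ge> 1\<close>,
    nonempty.\<close>
  define c where "c = Min ((\<lambda>\<xi>. \<integral>y. \<xi> y \<partial>?M) ` \<Xi>) / 2"
  have Min: "0 < Min ((\<lambda>\<xi>. \<integral>y. \<xi> y \<partial>?M) ` \<Xi>)" using \<Xi> by (subst Min_gr_iff) auto
  then have c: "0 < c" by (simp add: c_def)
  have c_less: "c < (\<integral>y. \<xi> y \<partial>?M)" if "\<xi> \<in> \<Xi>" for \<xi>
  proof -
    have "Min ((\<lambda>\<xi>. \<integral>y. \<xi> y \<partial>?M) ` \<Xi>) \<le> (\<integral>y. \<xi> y \<partial>?M)" using \<Xi>(1) that by (intro Min_le) auto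
    then show ?thesis using Min by (simp add: c_def)
  qed
  have "AE y in ?M. \<forall>t\<in>{1..T}. integrable (Mker m t (y (t - 1))) (G t)"
    using r_def by (intro AE_finite_allI) (auto simp: r_defined_def)
  moreover have "AE y in ?M. \<forall>t\<in>{1..T-1}. bs \<longrightarrow> integrable (Mker m t (y (t - 1))) (\<lambda>z. G t z * m (t + 1) z (y (t + 1)))"
    using b_def by (intro AE_finite_allI AE_impI) (auto simp: b_defined_def)
  ultimately have "AE y in ?M. regular bs T y"
    using AE_fk_target_transition_pos
  proof eventually_elim
    case (elim y)
    \<comment> \<open>The transition out of time \<open>t\<close> is the transition into
      \<open>t + 1\<close>, which is still at most \<open>T\<close>.\<close>
    have "0 < m (t + 1) (y t) (y (t + 1))" if "t \<in> {1..T-1}" for t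
      using bspec[OF elim(3), of "t + 1"] that by auto
    then show ?case using elim(1,2) by (auto simp: regular_def)
  qed
  \<comment> \<open>\<open>regular\<close> is known only to hold almost everywhere, so it is
    replaced by a measurable set of full measure on which it holds at every point.\<close>
  then obtain \<Omega> where \<Omega>: "\<Omega> \<in> sets ?M" "AE y in ?M. y \<in> \<Omega>" "\<And>y. y \<in> \<Omega> \<Longrightarrow> regular bs T y"
  proof (rule AE_E)
    fix S assume S: "{y \<in> space ?M. \<not> regular bs T y} \<subseteq> S" "emeasure ?M S = 0" "S \<in> sets ?M"
    then have "S \<in> null_sets ?M" by auto
    from AE_not_in[OF this] have "AE y in ?M. y \<in> space ?M - S" using AE_space by eventually_elim auto
    then show thesis using S by (intro that[of "space ?M - S"]) auto
  qed
  define F where "F D = {x \<in> space (path_space T D). (\<forall>d\<in>{1..D}. ?y x d \<in> \<Omega>) \<and>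
      (\<forall>\<xi>\<in>\<Xi>. c * real D < (\<Sum>d=1..D. \<xi> (?y x d)))}" for D
  have F: "F D \<in> sets (path_space T D)" "(\<lambda>D. measure (fk_target_prod m G T D) (F D)) \<longlonglongrightarrow> 1" for D
    using typical_sets[OF target sets_fk_target \<Omega>(1,2) \<Xi>(1,3) c_less]
    unfolding F_def fk_target_prod_def by auto
  have dist: "icsmc_dist bs fm m G N T D x \<in> {0..2 * real T * (real N)\<^sup>2 * exp (- (c * real D))}"
    if "x \<in> F D" "N \<ge> 1" for N D x
  proof -
    have "dominant bs T D (exp (- (c * real D))) x"
      using that(1) \<Omega>(3) by (intro dominant_of_columns) (auto simp: F_def \<Xi>_def less_imp_le)
    then show ?thesis using that(2) T by (intro icsmc_dist_dominant) auto
  qed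
  have "(\<lambda>D. SUP x\<in>F D. icsmc_dist bs fm m G (N D) T D x) \<longlonglongrightarrow> 0"
    if N: "\<forall>D\<ge>1. N D \<ge> 1" "(\<lambda>D. ln (real (N D))) \<in> o(\<lambda>D. real D)" for N :: "nat \<Rightarrow> nat"
  proof (rule tendsto_sandwich[of "\<lambda>_. 0" _ _ "\<lambda>D. 2 * real T * (real (N D))\<^sup>2 * exp (- (c * real D))"])
    \<comment> \<open>A real supremum over an empty set has no useful value; since the measures tend
      to \<open>1\<close>, the sets \<open>F D\<close> are eventually nonempty.\<close>
    have "\<forall>\<^sub>F D in sequentially. 0 < measure (fk_target_prod m G T D) (F D)"
      using F(2) by (rule order_tendstoD) simp
    then have ev: "\<forall>\<^sub>F D in sequentially. F D \<noteq> {} \<and> N D \<ge> 1"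
      using eventually_ge_at_top[of 1]
    proof eventually_elim
      case (elim D)
      then show ?case using N(1) by (cases "F D = {}") auto
    qed
    then show "\<forall>\<^sub>F D in sequentially. (SUP x\<in>F D. icsmc_dist bs fm m G (N D) T D x)
        \<le> 2 * real T * (real (N D))\<^sup>2 * exp (- (c * real D))"
      by eventually_elim (use dist in \<open>auto intro!: cSUP_least\<close>)
    from ev show "\<forall>\<^sub>F D in sequentially. 0 \<le> (SUP x\<in>F D. icsmc_dist bs fm m G (N D) T D x)"
    proof eventually_elim
      case (elim D)
      then obtain x where x: "x \<in> F D" by auto
      have "bdd_above ((\<lambda>x. icsmc_dist bs fm m G (N D) T D x) ` F D)"
        using dist elim by (intro bdd_aboveI2[where M="2 * real T * (real (N D))\<^sup>2 * exp (- (c * real D))"]) auto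
      then show ?case using dist[OF x] elim by (intro cSUP_upper2[OF _ x]) auto
    qed
    show "(\<lambda>D. 2 * real T * (real (N D))\<^sup>2 * exp (- (c * real D))) \<longlonglongrightarrow> 0"
      using N by (intro uniform_dominance_limit c) auto
  qed auto
  then show ?thesis using F by (intro exI[of _ F]) auto
qed

end
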